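(* There exists a constant $c$ such that for every binary string $x\in\{0,1\}^*$, $$\Big|\limsup_{n\to\infty} \mathit{KA}(x\mid n)-\mathit{KA}^{\mathbf{0}'}(x)\Big|\le c.$$
   Context: A semimeasure on the binary tree is a function $a:\{0,1\}^*\to[0,1]$ with $a(\Lambda)\le 1$ (where $\Lambda$ is the empty string) and $a(y)\ge a(y0)+a(y1)$ for all strings $y$. Such $a$ is lower semicomputable if there is a computable total rational-valued function $(y,s)\mapsto a(y,s)$, nondecreasing in $s$, with limit $a(y)$. The a priori complexity $\mathit{KA}(x)$ is $-\log_2 a(x)$ for a maximal (up to a constant factor) lower semicomputable semimeasure $a$ on the binary tree. The conditional version $\mathit{KA}(x\mid n)=-\log_2 a(x\mid n)$, where $a(x\mid n)$ is maximal (up to a constant factor) among functions lower semicomputable in $(x,n)$ such that $x\mapsto a(x\mid n)$ is a semimeasure on the binary tree for every $n$. $\mathbf{0}'$ denotes the halting problem, and $\mathit{KA}^{\mathbf{0}'}$ is the a priori complexity relativized to the oracle $\mathbf{0}'$ (using a maximal semimeasure on the binary tree lower semicomputable relative to $\mathbf{0}'$). *)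

theory Defs
  imports Complex_Main "HOL-Library.Nat_Bijection" "HOL-Library.Countable"
    "HOL-Library.Extended_Real" "HOL-Library.Liminf_Limsup"
begin

text \<open>Partial recursive functions relative to a set \<open>A\<close> of natural numbers, presented as unary
  functions; several arguments are passed through the pairing function \<^const>\<open>prod_encode\<close>.\<close>

datatype code =
    Zero | Succ | Left | Right | Query
  | Tuple code code
  | Comp code code
  | PrimRec code code
  | Search code

primrec run :: "nat set \<Rightarrow> code \<Rightarrow> nat \<Rightarrow> nat option" where
  "run A Zero x = Some 0"
| "run A Succ x = Some (Suc x)"
| "run A Left x = Some (fst (prod_decode x))"
| "run A Right x = Some (snd (prod_decode x))"
| "run A Query x = Some (if x \<in> A then 1 else 0)"
| "run A (Tuple f g) x =
     Option.bind (run A f x) (\<lambda>u. Option.bind (run A g x) (\<lambda>v. Some (prod_encode (u, v))))"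
| "run A (Comp f g) x = Option.bind (run A g x) (run A f)"
| "run A (PrimRec f g) x =
     (case prod_decode x of (y, m) \<Rightarrow>
        rec_nat (run A f y)
          (\<lambda>k r. Option.bind r (\<lambda>v. run A g (prod_encode (y, prod_encode (k, v))))) m)"
| "run A (Search f) x =
     (let found = (\<lambda>m. run A f (prod_encode (x, m)) = Some 0 \<and>
                       (\<forall>k<m. \<exists>v. run A f (prod_encode (x, k)) = Some (Suc v)))
      in if \<exists>m. found m then Some (THE m. found m) else None)"

primrec code_num :: "code \<Rightarrow> nat" where
  "code_num Zero = prod_encode (0, 0)"
| "code_num Succ = prod_encode (1, 0)"
| "code_num Left = prod_encode (2, 0)"
| "code_num Right = prod_encode (3, 0)"
| "code_num Query = prod_encode (4, 0)"
| "code_num (Tuple f g) = prod_encode (5, prod_encode (code_num f, code_num g))"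
| "code_num (Comp f g) = prod_encode (6, prod_encode (code_num f, code_num g))"
| "code_num (PrimRec f g) = prod_encode (7, prod_encode (code_num f, code_num g))"
| "code_num (Search f) = prod_encode (8, code_num f)"

text \<open>With the empty set \<^const>\<open>Query\<close> is constantly \<open>0\<close>, so \<open>run {}\<close> is ordinary
  computability.\<close>

definition halting_problem :: "nat set" where
  "halting_problem = {prod_encode (code_num p, x) | p x. run {} p x \<noteq> None}"

definition string_encode :: "bool list \<Rightarrow> nat" where
  "string_encode x = list_encode (map of_bool x)"

text \<open>Rational outputs are named by integer fractions: \<open>nat_to_rat_surj\<close> decodes a pair
  (numerator, denominator).\<close>

definition computable_rat :: "nat set \<Rightarrow> ('a \<Rightarrow> nat) \<Rightarrow> ('a \<Rightarrow> rat) \<Rightarrow> bool" where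
  "computable_rat A enc q \<longleftrightarrow>
     (\<exists>p. \<forall>x. \<exists>v. run A p (enc x) = Some v \<and> nat_to_rat_surj v = q x)"

definition lower_semicomputable :: "nat set \<Rightarrow> ('a \<Rightarrow> nat) \<Rightarrow> ('a \<Rightarrow> real) \<Rightarrow> bool" where
  "lower_semicomputable A enc f \<longleftrightarrow>
     (\<exists>q :: 'a \<times> nat \<Rightarrow> rat.
        computable_rat A (\<lambda>(x, s). prod_encode (enc x, s)) q \<and>
        (\<forall>x. mono (\<lambda>s. q (x, s))) \<and>
        (\<forall>x. (\<lambda>s. of_rat (q (x, s))) \<longlonglongrightarrow> f x))"

definition semimeasure :: "(bool list \<Rightarrow> real) \<Rightarrow> bool" where
  "semimeasure a \<longleftrightarrow>
     (\<forall>y. 0 \<le> a y \<and> a y \<le> 1) \<and> (\<forall>y. a (y @ [False]) + a (y @ [True]) \<le> a y)"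

definition lsc_semimeasure :: "nat set \<Rightarrow> (bool list \<Rightarrow> real) \<Rightarrow> bool" where
  "lsc_semimeasure A a \<longleftrightarrow> semimeasure a \<and> lower_semicomputable A string_encode a"

definition maximal_lsc_semimeasure :: "nat set \<Rightarrow> (bool list \<Rightarrow> real) \<Rightarrow> bool" where
  "maximal_lsc_semimeasure A a \<longleftrightarrow>
     lsc_semimeasure A a \<and>
     (\<forall>b. lsc_semimeasure A b \<longrightarrow> (\<exists>C>0. \<forall>x. b x \<le> C * a x))"

definition cond_lsc_semimeasure :: "nat set \<Rightarrow> (bool list \<Rightarrow> nat \<Rightarrow> real) \<Rightarrow> bool" where
  "cond_lsc_semimeasure A a \<longleftrightarrow>
     (\<forall>n. semimeasure (\<lambda>x. a x n)) \<and>
     lower_semicomputable A (\<lambda>(x, n). prod_encode (string_encode x, n)) (\<lambda>(x, n). a x n)"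

definition maximal_cond_lsc_semimeasure :: "nat set \<Rightarrow> (bool list \<Rightarrow> nat \<Rightarrow> real) \<Rightarrow> bool" where
  "maximal_cond_lsc_semimeasure A a \<longleftrightarrow>
     cond_lsc_semimeasure A a \<and>
     (\<forall>b. cond_lsc_semimeasure A b \<longrightarrow> (\<exists>C>0. \<forall>x n. b x n \<le> C * a x n))"

definition neg_log2 :: "real \<Rightarrow> ereal" where
  "neg_log2 p = (if p > 0 then ereal (- log 2 p) else \<infinity>)"

definition KA :: "(bool list \<Rightarrow> real) \<Rightarrow> bool list \<Rightarrow> ereal" where
  "KA a x = neg_log2 (a x)"

definition KA_cond :: "(bool list \<Rightarrow> nat \<Rightarrow> real) \<Rightarrow> bool list \<Rightarrow> nat \<Rightarrow> ereal" where
  "KA_cond a x n = neg_log2 (a x n)"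

end

theory Submission
  imports Defs "HOL-Library.Sublist"
begin

text \<open>
  Both inequalities compare semimeasures up to a constant factor, with \<open>limsup KA(x | n)\<close> turned into
  \<open>liminf a(x | n)\<close>.

  \<^item> A semimeasure \<open>m\<close> that is lower semicomputable in the halting problem is a double limit of
    computable approximations: at time \<open>n\<close> replace the oracle by what has been enumerated so far. The
    semimeasure with condition \<open>n\<close> follows the stages of the approximation to \<open>m\<close> whose weights have
    sum at most \<open>1\<close> on every prefix-free set. Every fixed stage is computed correctly for all large
    \<open>n\<close>, so the \<open>liminf\<close> is at least \<open>m\<close>.

  \<^item> Conversely \<open>liminf a(x | n)\<close> is not obviously lower semicomputable in the halting problem (its
    definition is \<open>\<Sigma>\<^sub>3\<close>). Instead one grants requests to raise a weight \<open>g(x)\<close> to a power of \<open>1/2\<close>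
    greedily: at stage \<open>s\<close> the request is granted if for all \<open>n \<ge> s\<close> the least semimeasure above
    \<open>max a(\<cdot> | n) g\<close> still has root value at most \<open>1\<close>. This is a \<open>\<Pi>\<^sub>1\<close> question, and a request with
    \<open>2^-j \<le> a(x | n)\<close> for all \<open>n \<ge> s\<close> changes nothing in these maxima, hence is granted.
\<close>

section \<open>Computable functions\<close>

definition pfst :: "nat \<Rightarrow> nat" where "pfst z = fst (prod_decode z)"
definition psnd :: "nat \<Rightarrow> nat" where "psnd z = snd (prod_decode z)"

lemma pfst_prod_encode [simp]: "pfst (prod_encode (a, b)) = a"
  and psnd_prod_encode [simp]: "psnd (prod_encode (a, b)) = b"
  and prod_encode_pfst_psnd [simp]: "prod_encode (pfst z, psnd z) = z"
  by (simp_all add: pfst_def psnd_def)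

lemma pfst_le: "pfst z \<le> z" and psnd_le: "psnd z \<le> z"
  using le_prod_encode_1[of "pfst z" "psnd z"] le_prod_encode_2[of "psnd z" "pfst z"] by simp_all

definition computable :: "nat set \<Rightarrow> (nat \<Rightarrow> nat) \<Rightarrow> bool" where
  "computable A f \<longleftrightarrow> (\<exists>p. \<forall>x. run A p x = Some (f x))"

definition decidable :: "nat set \<Rightarrow> (nat \<Rightarrow> bool) \<Rightarrow> bool" where
  "decidable A P \<longleftrightarrow> computable A (\<lambda>x. of_bool (P x))"

abbreviation computable2 :: "nat set \<Rightarrow> (nat \<Rightarrow> nat \<Rightarrow> nat) \<Rightarrow> bool" where
  "computable2 A F \<equiv> computable A (\<lambda>z. F (pfst z) (psnd z))"

abbreviation computable3 :: "nat set \<Rightarrow> (nat \<Rightarrow> nat \<Rightarrow> nat \<Rightarrow> nat) \<Rightarrow> bool" where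
  "computable3 A F \<equiv> computable A (\<lambda>z. F (pfst z) (pfst (psnd z)) (psnd (psnd z)))"

abbreviation decidable2 :: "nat set \<Rightarrow> (nat \<Rightarrow> nat \<Rightarrow> bool) \<Rightarrow> bool" where
  "decidable2 A P \<equiv> decidable A (\<lambda>z. P (pfst z) (psnd z))"

named_theorems computable_intros

lemma computable_comp:
  assumes "computable A F" "computable A f"
  shows "computable A (\<lambda>x. F (f x))"
proof -
  obtain p q where "\<And>x. run A p x = Some (F x)" "\<And>x. run A q x = Some (f x)"
    using assms by (auto simp: computable_def)
  then have "\<forall>x. run A (Comp p q) x = Some (F (f x))" by simp
  then show ?thesis unfolding computable_def by blast
qed

lemma computable_pair [computable_intros]:
  assumes "computable A f" "computable A g"
  shows "computable A (\<lambda>x. prod_encode (f x, g x))"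
proof -
  obtain p q where "\<And>x. run A p x = Some (f x)" "\<And>x. run A q x = Some (g x)"
    using assms by (auto simp: computable_def)
  then have "\<forall>x. run A (Tuple p q) x = Some (prod_encode (f x, g x))" by simp
  then show ?thesis unfolding computable_def by blast
qed

lemma computable_pfst [computable_intros]: "computable A f \<Longrightarrow> computable A (\<lambda>x. pfst (f x))"
  by (rule computable_comp) (auto simp: computable_def pfst_def intro: exI[of _ Left])

lemma computable_psnd [computable_intros]: "computable A f \<Longrightarrow> computable A (\<lambda>x. psnd (f x))"
  by (rule computable_comp) (auto simp: computable_def psnd_def intro: exI[of _ Right])

lemma computable_Suc [computable_intros]: "computable A f \<Longrightarrow> computable A (\<lambda>x. Suc (f x))"
  by (rule computable_comp) (auto simp: computable_def intro: exI[of _ Succ])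

lemma computable_id [computable_intros]: "computable A (\<lambda>x. x)"
proof -
  have "\<forall>x. run A (Tuple Left Right) x = Some x" by simp
  then show ?thesis unfolding computable_def by blast
qed

lemma computable_const [computable_intros]: "computable A (\<lambda>x. c)"
proof (induction c)
  case 0
  show ?case by (auto simp: computable_def intro: exI[of _ Zero])
qed (rule computable_Suc)

lemma computable_comp2:
  assumes "computable2 A F" "computable A f" "computable A g"
  shows "computable A (\<lambda>x. F (f x) (g x))"
  using computable_comp[OF assms(1) computable_pair[OF assms(2,3)]] by simp

lemma computable_comp3:
  assumes "computable3 A F" "computable A f" "computable A g" "computable A h"
  shows "computable A (\<lambda>x. F (f x) (g x) (h x))"
  using computable_comp[OF assms(1) computable_pair[OF assms(2) computable_pair[OF assms(3,4)]]]
  by simp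

lemma decidable_comp: "decidable A P \<Longrightarrow> computable A f \<Longrightarrow> decidable A (\<lambda>x. P (f x))"
  unfolding decidable_def by (rule computable_comp)

lemma decidable_comp2:
  "decidable2 A P \<Longrightarrow> computable A f \<Longrightarrow> computable A g \<Longrightarrow> decidable A (\<lambda>x. P (f x) (g x))"
  unfolding decidable_def by (rule computable_comp2)

lemma computable_rec_nat:
  assumes "computable A b" "computable3 A g" "computable A m"
  shows "computable A (\<lambda>x. rec_nat (b x) (g x) (m x))"
proof -
  obtain p q where p: "\<And>x. run A p x = Some (b x)"
    and q: "\<And>z. run A q z = Some (g (pfst z) (pfst (psnd z)) (psnd (psnd z)))"
    using assms by (auto simp: computable_def)
  have "run A (PrimRec p q) z = Some (rec_nat (b (pfst z)) (g (pfst z)) (psnd z))" for z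
  proof -
    have "rec_nat (run A p y)
        (\<lambda>k r. Option.bind r (\<lambda>v. run A q (prod_encode (y, prod_encode (k, v))))) k
      = Some (rec_nat (b y) (g y) k)" for y k
      by (induction k) (auto simp: p q)
    then show ?thesis by (simp add: pfst_def psnd_def split: prod.split)
  qed
  then have "computable2 A (\<lambda>y. rec_nat (b y) (g y))"
    unfolding computable_def by blast
  then show ?thesis by (rule computable_comp2[OF _ computable_id assms(3)])
qed

lemma computable_primrec:
  assumes "\<And>x. F x 0 = b x" "\<And>x k. F x (Suc k) = g x k (F x k)"
    and "computable A b" "computable3 A g" "computable A m"
  shows "computable A (\<lambda>x. F x (m x))"
proof -
  have "rec_nat (b x) (g x) k = F x k" for x k by (induction k) (simp_all add: assms(1,2))
  then show ?thesis using computable_rec_nat[OF assms(3-5)] by simp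
qed

lemma computable_add [computable_intros]:
  assumes "computable A f" "computable A g"
  shows "computable A (\<lambda>x. f x + g x)"
  by (rule computable_primrec[where F = "\<lambda>x m. f x + m" and g = "\<lambda>x k r. Suc r"])
    (simp_all, (intro computable_intros assms)+)

lemma computable_diff [computable_intros]:
  assumes "computable A f" "computable A g"
  shows "computable A (\<lambda>x. f x - g x)"
proof -
  have pred: "computable A (\<lambda>x. x - 1)"
    by (rule computable_primrec[where F = "\<lambda>x m. m - 1" and g = "\<lambda>x k r. k"])
      (simp_all, (intro computable_intros)+)
  show ?thesis
    by (rule computable_primrec[where F = "\<lambda>x m. f x - m" and g = "\<lambda>x k r. r - 1"])
      (simp_all del: One_nat_def, (intro computable_comp[OF pred] computable_intros assms)+)
qed

lemma computable_mult [computable_intros]: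
  assumes "computable A f" "computable A g"
  shows "computable A (\<lambda>x. f x * g x)"
  by (rule computable_primrec[where F = "\<lambda>x m. f x * m" and g = "\<lambda>x k r. r + f x"])
    (simp_all, (intro computable_intros computable_comp[OF assms(1)] assms(2))+)

lemma computable_power [computable_intros]:
  assumes "computable A f" "computable A g"
  shows "computable A (\<lambda>x. f x ^ g x)"
  by (rule computable_primrec[where F = "\<lambda>x m. f x ^ m" and g = "\<lambda>x k r. r * f x"])
    (simp_all, (intro computable_intros computable_comp[OF assms(1)] assms(2))+)

lemma decidable_le [computable_intros]:
  assumes "computable A f" "computable A g"
  shows "decidable A (\<lambda>x. f x \<le> g x)"
proof -
  have "computable A (\<lambda>x. 1 - (f x - g x))"
    by (intro computable_intros assms)
  moreover have "1 - (a - b) = (of_bool (a \<le> b) :: nat)" for a b :: nat by auto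
  ultimately show ?thesis by (simp add: decidable_def)
qed

lemma decidable_not [computable_intros]:
  assumes "decidable A P"
  shows "decidable A (\<lambda>x. \<not> P x)"
proof -
  have "computable A (\<lambda>x. 1 - of_bool (P x))"
    by (intro computable_intros assms[unfolded decidable_def])
  moreover have "1 - of_bool b = (of_bool (\<not> b) :: nat)" for b by auto
  ultimately show ?thesis by (simp add: decidable_def)
qed

lemma decidable_conj [computable_intros]:
  "decidable A P \<Longrightarrow> decidable A Q \<Longrightarrow> decidable A (\<lambda>x. P x \<and> Q x)"
  unfolding decidable_def of_bool_conj by (rule computable_mult)

lemma decidable_disj [computable_intros]:
  "decidable A P \<Longrightarrow> decidable A Q \<Longrightarrow> decidable A (\<lambda>x. P x \<or> Q x)"
  using decidable_not[OF decidable_conj[OF decidable_not[of A P] decidable_not[of A Q]]] by simp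

lemma decidable_imp [computable_intros]:
  "decidable A P \<Longrightarrow> decidable A Q \<Longrightarrow> decidable A (\<lambda>x. P x \<longrightarrow> Q x)"
  unfolding imp_conv_disj by (intro decidable_disj decidable_not)

lemma decidable_less [computable_intros]:
  "computable A f \<Longrightarrow> computable A g \<Longrightarrow> decidable A (\<lambda>x. f x < g x)"
  using decidable_not[OF decidable_le[of A g f]] by (simp add: not_le)

lemma decidable_eq [computable_intros]:
  "computable A f \<Longrightarrow> computable A g \<Longrightarrow> decidable A (\<lambda>x. f x = g x)"
  using decidable_conj[OF decidable_le[of A f g] decidable_le[of A g f]] by (simp add: eq_iff)

lemma decidable_iff [computable_intros]:
  "decidable A P \<Longrightarrow> decidable A Q \<Longrightarrow> decidable A (\<lambda>x. P x \<longleftrightarrow> Q x)"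
  unfolding iff_conv_conj_imp by (intro decidable_conj decidable_imp)

lemma computable_if [computable_intros]:
  assumes "decidable A P" "computable A f" "computable A g"
  shows "computable A (\<lambda>x. if P x then f x else g x)"
proof -
  have "computable A (\<lambda>x. of_bool (P x) * f x + (1 - of_bool (P x)) * g x)"
    by (intro computable_intros assms assms(1)[unfolded decidable_def])
  moreover have "of_bool b * u + (1 - of_bool b) * v = (if b then u else v)" for b and u v :: nat
    by simp
  ultimately show ?thesis by simp
qed

lemma computable_max [computable_intros]:
  "computable A f \<Longrightarrow> computable A g \<Longrightarrow> computable A (\<lambda>x. max (f x) (g x))"
  unfolding max_def by (intro computable_if decidable_le)

lemma computable_sum [computable_intros]:
  assumes "computable2 A F" "computable A m"
  shows "computable A (\<lambda>x. \<Sum>k<m x. F x k)"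
  by (rule computable_primrec[where F = "\<lambda>x m. \<Sum>k<m. F x k" and g = "\<lambda>x k r. r + F x k"])
    (simp_all, (intro computable_intros computable_comp2[OF assms(1)] assms(2))+)

primrec max_below :: "(nat \<Rightarrow> nat) \<Rightarrow> nat \<Rightarrow> nat" where
  "max_below F 0 = 0"
| "max_below F (Suc k) = max (max_below F k) (F k)"

lemma max_below_le_iff: "max_below F m \<le> c \<longleftrightarrow> (\<forall>k<m. F k \<le> c)"
  by (induction m) (auto simp: less_Suc_eq)

lemma max_below_ge: "k < m \<Longrightarrow> F k \<le> max_below F m"
  using max_below_le_iff[of F m "max_below F m"] by simp

lemma max_below_attained: "0 < m \<Longrightarrow> \<exists>k<m. max_below F m = F k"
proof (induction m)
  case (Suc m)
  then show ?case by (cases "m = 0") (auto simp: max_def less_Suc_eq)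
qed simp

lemma computable_max_below [computable_intros]:
  assumes "computable2 A F" "computable A m"
  shows "computable A (\<lambda>x. max_below (F x) (m x))"
  by (rule computable_primrec[where F = "\<lambda>x. max_below (F x)" and g = "\<lambda>x k r. max r (F x k)"])
    (simp_all, (intro computable_intros computable_comp2[OF assms(1)] assms(2))+)

lemma decidable_bex_less [computable_intros]:
  assumes "decidable2 A P" "computable A m"
  shows "decidable A (\<lambda>x. \<exists>k<m x. P x k)"
proof -
  have "computable A (\<lambda>x. max_below (\<lambda>k. of_bool (P x k)) (m x))"
    by (intro computable_max_below assms(1)[unfolded decidable_def] assms(2))
  moreover have "max_below (\<lambda>k. of_bool (P x k)) m = of_bool (\<exists>k<m. P x k)" for x m
    by (induction m) (auto simp: less_Suc_eq)
  ultimately show ?thesis by (simp add: decidable_def)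
qed

lemma decidable_ball_less [computable_intros]:
  assumes "decidable2 A P" "computable A m"
  shows "decidable A (\<lambda>x. \<forall>k<m x. P x k)"
  using decidable_not[OF decidable_bex_less[OF decidable_not[OF assms(1)] assms(2)]] by simp

lemma computable_div [computable_intros]:
  assumes "computable A f" "computable A g"
  shows "computable A (\<lambda>x. f x div g x)"
proof -
  let ?F = "\<lambda>a b k. if k * b \<le> a \<and> b \<noteq> 0 then k else 0"
  have "max_below (?F a b) (Suc a) = a div b" for a b
  proof (rule antisym)
    show "max_below (?F a b) (Suc a) \<le> a div b"
      by (auto simp: max_below_le_iff less_eq_div_iff_mult_less_eq)
    have "a div b = ?F a b (a div b)" by (cases "b = 0") simp_all
    also have "\<dots> \<le> max_below (?F a b) (Suc a)"
      by (intro max_below_ge) (simp add: le_imp_less_Suc)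
    finally show "a div b \<le> max_below (?F a b) (Suc a)" .
  qed
  moreover have "computable A (\<lambda>x. max_below (?F (f x) (g x)) (Suc (f x)))"
    by (intro computable_intros computable_comp[OF assms(1)] computable_comp[OF assms(2)] assms)
  ultimately show ?thesis by simp
qed

lemma decidable_even [computable_intros]:
  assumes "computable A f"
  shows "decidable A (\<lambda>x. even (f x))"
proof -
  have "decidable A (\<lambda>x. f x = 2 * (f x div 2))"
    by (intro computable_intros assms)
  moreover have "n = 2 * (n div 2) \<longleftrightarrow> even n" for n :: nat by presburger
  ultimately show ?thesis by simp
qed

lemma computable_funpow:
  assumes "computable A F" "computable A b" "computable A m"
  shows "computable A (\<lambda>x. (F ^^ m x) (b x))"
  by (rule computable_primrec[where F = "\<lambda>x m. (F ^^ m) (b x)" and g = "\<lambda>x k r. F r"])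
    (simp_all, (intro computable_intros computable_comp[OF assms(1)] assms(2,3))+)

lemma decidable_set_decode [computable_intros]:
  assumes "computable A f" "computable A g"
  shows "decidable A (\<lambda>x. f x \<in> set_decode (g x))"
  unfolding set_decode_def mem_Collect_eq by (intro computable_intros assms)

lemma set_decode_imp_power_le: "i \<in> set_decode w \<Longrightarrow> 2 ^ i \<le> w"
  unfolding set_decode_def by (metis div_less even_zero linorder_not_le mem_Collect_eq)

lemma set_decode_less: "i \<in> set_decode w \<Longrightarrow> i < w"
  using set_decode_imp_power_le less_exp order_less_le_trans by blast

lemma set_decode_subset_lessThan_iff: "set_decode w \<subseteq> {..<s} \<longleftrightarrow> w < 2 ^ s"
proof
  assume "set_decode w \<subseteq> {..<s}"
  then have "(\<Sum>i\<in>set_decode w. 2 ^ i) \<le> (\<Sum>i<s. 2 ^ i :: nat)" by (intro sum_mono2) auto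
  then have "w \<le> (\<Sum>i<s. 2 ^ i)" by (metis set_decode_inverse set_encode_def)
  also have "\<dots> = 2 ^ s - 1" using sum_power2[of s] by (simp add: atLeast0LessThan)
  finally show "w < 2 ^ s" using zero_less_power[of "2::nat" s] by linarith
next
  assume w: "w < 2 ^ s"
  have "(2::nat) ^ i < 2 ^ s" if "i \<in> set_decode w" for i
    using set_decode_imp_power_le[OF that] w by linarith
  then show "set_decode w \<subseteq> {..<s}" by auto
qed

lemma decidable_bex_set_decode [computable_intros]:
  assumes "decidable2 A P" "computable A g"
  shows "decidable A (\<lambda>x. \<exists>k\<in>set_decode (g x). P x k)"
proof -
  have "decidable A (\<lambda>x. \<exists>k<g x. k \<in> set_decode (g x) \<and> P x k)"
    by (intro computable_intros assms computable_comp[OF assms(2)])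
  moreover have "(\<exists>k<w. k \<in> set_decode w \<and> Q k) \<longleftrightarrow> (\<exists>k\<in>set_decode w. Q k)" for w Q
    using set_decode_less by blast
  ultimately show ?thesis by simp
qed

lemma decidable_ball_set_decode [computable_intros]:
  assumes "decidable2 A P" "computable A g"
  shows "decidable A (\<lambda>x. \<forall>k\<in>set_decode (g x). P x k)"
  using decidable_not[OF decidable_bex_set_decode[OF decidable_not[OF assms(1)] assms(2)]] by simp

lemma computable_sum_set_decode [computable_intros]:
  assumes "computable2 A F" "computable A g"
  shows "computable A (\<lambda>x. \<Sum>k\<in>set_decode (g x). F x k)"
proof -
  have "computable A (\<lambda>x. \<Sum>k<g x. if k \<in> set_decode (g x) then F x k else 0)"
    by (intro computable_intros assms computable_comp[OF assms(2)])
  moreover have "(\<Sum>k<w. if k \<in> set_decode w then G k else 0) = (\<Sum>k\<in>set_decode w. G k)"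
    for w and G :: "nat \<Rightarrow> nat"
    by (subst sum.inter_restrict[symmetric]) (auto intro!: sum.cong dest: set_decode_less)
  ultimately show ?thesis by simp
qed

declare run.simps(9) [simp del]

lemma run_Search_eq_Some_iff:
  "run A (Search f) x = Some m \<longleftrightarrow>
     run A f (prod_encode (x, m)) = Some 0 \<and>
     (\<forall>k<m. \<exists>v. run A f (prod_encode (x, k)) = Some (Suc v))"
proof -
  define found where "found m \<longleftrightarrow> run A f (prod_encode (x, m)) = Some 0 \<and>
     (\<forall>k<m. \<exists>v. run A f (prod_encode (x, k)) = Some (Suc v))" for m
  have run: "run A (Search f) x = (if \<exists>m. found m then Some (THE m. found m) else None)"
    by (simp add: run.simps(9) Let_def found_def)
  have "\<not> found m'" if "found m" "m < m'" for m m'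
    using that unfolding found_def by fastforce
  then have "m = m'" if "found m" "found m'" for m m'
    using that by (metis linorder_neqE_nat)
  then have "(THE m. found m) = m" if "found m" for m
    using that by blast
  then have "run A (Search f) x = Some m \<longleftrightarrow> found m"
    unfolding run by auto
  then show ?thesis by (simp add: found_def)
qed

lemma run_Search_total:
  assumes "\<And>m. run A f (prod_encode (x, m)) = Some (F m)"
  shows "run A (Search f) x \<noteq> None \<longleftrightarrow> (\<exists>m. F m = 0)"
proof
  assume "run A (Search f) x \<noteq> None"
  then obtain m where "run A (Search f) x = Some m" by blast
  then show "\<exists>m. F m = 0" unfolding run_Search_eq_Some_iff assms by auto
next
  assume "\<exists>m. F m = 0"
  define m where "m = (LEAST m. F m = 0)"
  have "F m = 0" unfolding m_def using \<open>\<exists>m. F m = 0\<close> by (rule LeastI_ex)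
  moreover have "F k \<noteq> 0" if "k < m" for k
    using that not_less_Least unfolding m_def by blast
  ultimately have "run A (Search f) x = Some m"
    unfolding run_Search_eq_Some_iff assms using not0_implies_Suc by simp
  then show "run A (Search f) x \<noteq> None" by simp
qed

section \<open>Enumerating the halting problem\<close>

text \<open>
  In both rule systems below the premises of a rule concern smaller programs or recursion arguments
  than its conclusion, so that even circular certificates certify only true statements. This makes
  halting a \<open>\<Sigma>\<^sub>1\<close> property without an interpreter.
\<close>

definition certificate :: "(nat set \<Rightarrow> nat \<Rightarrow> bool) \<Rightarrow> nat \<Rightarrow> bool" where
  "certificate R w \<longleftrightarrow> (\<forall>z\<in>set_decode w. R (set_decode w) z)"

definition certified :: "(nat set \<Rightarrow> nat \<Rightarrow> bool) \<Rightarrow> nat \<Rightarrow> bool" where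
  "certified R z \<longleftrightarrow> (\<exists>w. certificate R w \<and> z \<in> set_decode w)"

definition certified_below :: "(nat set \<Rightarrow> nat \<Rightarrow> bool) \<Rightarrow> nat \<Rightarrow> nat \<Rightarrow> bool" where
  "certified_below R n z \<longleftrightarrow> (\<exists>w<n. certificate R w \<and> z \<in> set_decode w)"

lemma certified_iff_below: "certified R z \<longleftrightarrow> (\<exists>n. certified_below R n z)"
  unfolding certified_def certified_below_def by blast

lemma certified_below_mono: "certified_below R n z \<Longrightarrow> n \<le> n' \<Longrightarrow> certified_below R n' z"
  unfolding certified_below_def using order_less_le_trans by blast

lemma certified_rule:
  assumes "mono R" "finite S" "R S z" and S: "\<And>y. y \<in> S \<Longrightarrow> certified R y"
  shows "certified R z"
proof -
  obtain w where w: "\<And>y. y \<in> S \<Longrightarrow> certificate R (w y) \<and> y \<in> set_decode (w y)"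
    using S unfolding certified_def by metis
  define T where "T = insert z (\<Union>y\<in>S. set_decode (w y))"
  have R_mono: "R V y \<Longrightarrow> V \<subseteq> T \<Longrightarrow> R T y" for V y
    using \<open>mono R\<close> by (metis le_boolD le_funD monoD)
  have "R T z" using R_mono[OF \<open>R S z\<close>] w unfolding T_def by blast
  moreover have "R T x" if "y \<in> S" "x \<in> set_decode (w y)" for x y
    using R_mono[of "set_decode (w y)" x] w[OF that(1)] that
    unfolding certificate_def T_def by blast
  ultimately have "\<forall>x\<in>T. R T x" unfolding T_def by blast
  moreover have "set_decode (set_encode T) = T" using \<open>finite S\<close> by (simp add: T_def)
  ultimately show ?thesis unfolding certified_def certificate_def T_def by (metis insertI1)
qed

lemma decidable_certified_below:
  assumes "decidable2 A (\<lambda>w z. R (set_decode w) z)"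
  shows "decidable2 A (certified_below R)"
  unfolding certified_below_def certificate_def
  by (intro computable_intros decidable_comp2[OF assms])

definition triple :: "nat \<Rightarrow> nat \<Rightarrow> nat \<Rightarrow> nat" where
  "triple e x y = prod_encode (e, prod_encode (x, y))"

lemma computable_triple [computable_intros]:
  "computable A e \<Longrightarrow> computable A x \<Longrightarrow> computable A y \<Longrightarrow>
    computable A (\<lambda>z. triple (e z) (x z) (y z))"
  unfolding triple_def by (intro computable_intros)

lemma triple_less: "triple e x y \<in> set_decode w \<Longrightarrow> y < w"
  using set_decode_less[of "triple e x y" w] le_prod_encode_2[of "prod_encode (x, y)" e]
    le_prod_encode_2[of y x] by (simp add: triple_def)

lemma decidable_ex_triple [computable_intros]:
  assumes "computable A e" "computable A x" "computable A w" "decidable2 A P"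
  shows "decidable A (\<lambda>z. \<exists>u. triple (e z) (x z) u \<in> set_decode (w z) \<and> P z u)"
proof -
  have "decidable A (\<lambda>z. \<exists>u<w z. triple (e z) (x z) u \<in> set_decode (w z) \<and> P z u)"
    by (intro computable_intros assms assms(1-3)[THEN computable_comp])
  moreover have "(\<exists>u<w'. triple e' x' u \<in> set_decode w' \<and> Q u) \<longleftrightarrow>
      (\<exists>u. triple e' x' u \<in> set_decode w' \<and> Q u)" for e' x' w' Q
    using triple_less by blast
  ultimately show ?thesis by simp
qed

text \<open>A triple \<open>(e, x, y)\<close> is read as ``program \<open>e\<close> maps \<open>x\<close> to \<open>y\<close>''.\<close>

definition eval_step :: "nat set \<Rightarrow> nat \<Rightarrow> nat \<Rightarrow> nat \<Rightarrow> bool" where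
  "eval_step S e x y \<longleftrightarrow>
     pfst e = 0 \<and> y = 0 \<or>
     pfst e = 1 \<and> y = Suc x \<or>
     pfst e = 2 \<and> y = pfst x \<or>
     pfst e = 3 \<and> y = psnd x \<or>
     pfst e = 4 \<and> y = 0 \<or>
     pfst e = 5 \<and> triple (pfst (psnd e)) x (pfst y) \<in> S \<and> triple (psnd (psnd e)) x (psnd y) \<in> S \<or>
     pfst e = 6 \<and> (\<exists>u. triple (psnd (psnd e)) x u \<in> S \<and> triple (pfst (psnd e)) u y \<in> S) \<or>
     pfst e = 7 \<and> psnd x = 0 \<and> triple (pfst (psnd e)) (pfst x) y \<in> S \<or>
     pfst e = 7 \<and> psnd x \<noteq> 0 \<and> (\<exists>v. triple e (prod_encode (pfst x, psnd x - 1)) v \<in> S \<and>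
       triple (psnd (psnd e)) (prod_encode (pfst x, prod_encode (psnd x - 1, v))) y \<in> S) \<or>
     pfst e = 8 \<and> triple (psnd e) (prod_encode (x, y)) 0 \<in> S \<and>
       (\<forall>k<y. \<exists>v. triple (psnd e) (prod_encode (x, k)) v \<in> S \<and> v \<noteq> 0)"

definition eval_rule :: "nat set \<Rightarrow> nat \<Rightarrow> bool" where
  "eval_rule S z \<longleftrightarrow> eval_step S (pfst z) (pfst (psnd z)) (psnd (psnd z))"

lemma eval_rule_triple [simp]: "eval_rule S (triple e x y) \<longleftrightarrow> eval_step S e x y"
  by (simp add: eval_rule_def triple_def)

lemma mono_eval_rule: "mono eval_rule"
proof (intro monoI le_funI le_boolI')
  fix S T :: "nat set" and z assume "S \<subseteq> T"
  then have "y \<in> S \<longrightarrow> y \<in> T" for y by blast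
  then show "eval_rule S z \<longrightarrow> eval_rule T z" unfolding eval_rule_def eval_step_def
    by (intro imp_refl disj_mono conj_mono ex_mono all_mono imp_mono)
qed

lemma decidable_eval_rule: "decidable2 A (\<lambda>w z. eval_rule (set_decode w) z)"
  unfolding eval_rule_def eval_step_def by (intro computable_intros)

lemma certificate_eval_step:
  "certificate eval_rule w \<Longrightarrow> triple e x y \<in> set_decode w \<Longrightarrow> eval_step (set_decode w) e x y"
  unfolding certificate_def by (metis eval_rule_triple)

lemma eval_rule_sound:
  assumes "certificate eval_rule w"
  shows "triple (code_num p) x y \<in> set_decode w \<Longrightarrow> run {} p x = Some y"
proof (induction p arbitrary: x y)
  case (Tuple f g)
  from certificate_eval_step[OF assms Tuple.prems]
  show ?case using Tuple.IH[of x] by (auto simp: eval_step_def)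
next
  case (Comp f g)
  from certificate_eval_step[OF assms Comp.prems]
  show ?case using Comp.IH by (fastforce simp: eval_step_def)
next
  case (PrimRec f g)
  have "triple (code_num (PrimRec f g)) (prod_encode (a, m)) y \<in> set_decode w \<Longrightarrow>
    run {} (PrimRec f g) (prod_encode (a, m)) = Some y" for a m y
  proof (induction m arbitrary: y)
    case 0
    from certificate_eval_step[OF assms this]
    show ?case using PrimRec.IH(1) by (auto simp: eval_step_def)
  next
    case (Suc m)
    from certificate_eval_step[OF assms Suc.prems] obtain v
      where "triple (code_num (PrimRec f g)) (prod_encode (a, m)) v \<in> set_decode w"
        and "triple (code_num g) (prod_encode (a, prod_encode (m, v))) y \<in> set_decode w"
      by (auto simp: eval_step_def)
    then show ?case using Suc.IH PrimRec.IH(2) by fastforce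
  qed
  from this[of "pfst x" "psnd x"] show ?case using PrimRec.prems by simp
next
  case (Search f)
  from certificate_eval_step[OF assms Search.prems]
  have "triple (code_num f) (prod_encode (x, y)) 0 \<in> set_decode w"
    and "\<forall>k<y. \<exists>v. triple (code_num f) (prod_encode (x, k)) v \<in> set_decode w \<and> v \<noteq> 0"
    by (auto simp: eval_step_def)
  then show ?case unfolding run_Search_eq_Some_iff using Search.IH not0_implies_Suc by blast
qed (auto dest!: certificate_eval_step[OF assms] simp: eval_step_def pfst_def psnd_def)

lemma certified_eval_step:
  assumes "eval_step S e x y" "finite S" "\<And>z. z \<in> S \<Longrightarrow> certified eval_rule z"
  shows "certified eval_rule (triple e x y)"
  by (rule certified_rule[OF mono_eval_rule, of S]) (simp_all add: assms)

lemma certified_eval_PrimRec: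
  assumes f: "\<And>x y. run {} f x = Some y \<Longrightarrow> certified eval_rule (triple (code_num f) x y)"
    and g: "\<And>x y. run {} g x = Some y \<Longrightarrow> certified eval_rule (triple (code_num g) x y)"
  shows "run {} (PrimRec f g) (prod_encode (a, m)) = Some y \<Longrightarrow>
    certified eval_rule (triple (code_num (PrimRec f g)) (prod_encode (a, m)) y)"
proof (induction m arbitrary: y)
  case 0
  then have "run {} f a = Some y" by simp
  then show ?case
    by (intro certified_eval_step[of "{triple (code_num f) a y}"])
      (auto simp: eval_step_def intro: f)
next
  case (Suc m)
  then obtain v where v: "run {} (PrimRec f g) (prod_encode (a, m)) = Some v"
    "run {} g (prod_encode (a, prod_encode (m, v))) = Some y"
    by (auto simp: bind_eq_Some_conv)
  let ?S = "{triple (code_num (PrimRec f g)) (prod_encode (a, m)) v,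
    triple (code_num g) (prod_encode (a, prod_encode (m, v))) y}"
  have "eval_step ?S (code_num (PrimRec f g)) (prod_encode (a, Suc m)) y"
    by (auto simp: eval_step_def)
  then show ?case
    using Suc.IH[OF v(1)] g[OF v(2)] by (intro certified_eval_step[of ?S]) auto
qed

lemma certified_eval_Search:
  assumes f: "\<And>x y. run {} f x = Some y \<Longrightarrow> certified eval_rule (triple (code_num f) x y)"
    and run: "run {} (Search f) x = Some y"
  shows "certified eval_rule (triple (code_num (Search f)) x y)"
proof -
  obtain v where v: "run {} f (prod_encode (x, y)) = Some 0"
    "\<And>k. k < y \<Longrightarrow> run {} f (prod_encode (x, k)) = Some (Suc (v k))"
    using run unfolding run_Search_eq_Some_iff by metis
  let ?S = "insert (triple (code_num f) (prod_encode (x, y)) 0)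
    ((\<lambda>k. triple (code_num f) (prod_encode (x, k)) (Suc (v k))) ` {..<y})"
  have "eval_step ?S (code_num (Search f)) x y"
    by (auto simp: eval_step_def)
  then show ?thesis using f v by (intro certified_eval_step[of ?S]) auto
qed

lemma certified_eval_complete:
  "run {} p x = Some y \<Longrightarrow> certified eval_rule (triple (code_num p) x y)"
proof (induction p arbitrary: x y)
  case (Tuple f g)
  then obtain u v where "run {} f x = Some u" "run {} g x = Some v" "y = prod_encode (u, v)"
    by (auto simp: bind_eq_Some_conv)
  then show ?case using Tuple.IH
    by (intro certified_eval_step[of "{triple (code_num f) x u, triple (code_num g) x v}"])
      (auto simp: eval_step_def)
next
  case (Comp f g)
  then obtain u where "run {} g x = Some u" "run {} f u = Some y"
    by (auto simp: bind_eq_Some_conv)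
  then show ?case using Comp.IH
    by (intro certified_eval_step[of "{triple (code_num g) x u, triple (code_num f) u y}"])
      (auto simp: eval_step_def)
next
  case (PrimRec f g)
  then show ?case using certified_eval_PrimRec[of f g "pfst x" "psnd x" y] by simp
next
  case (Search f)
  then show ?case by (intro certified_eval_Search)
qed (auto intro!: certified_eval_step[of "{}"] simp: eval_step_def pfst_def psnd_def)

lemma certified_eval_iff_run:
  "certified eval_rule (triple (code_num p) x y) \<longleftrightarrow> run {} p x = Some y"
  using certified_eval_complete eval_rule_sound by (auto simp: certified_def)

text \<open>
  A certificate for a \<^const>\<open>PrimRec\<close> with recursion argument \<open>0\<close> never looks at the step program, so
  that \<open>e\<close> is a program number at all has to be certified separately.
\<close>

definition program_rule :: "nat set \<Rightarrow> nat \<Rightarrow> bool" where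
  "program_rule S e \<longleftrightarrow>
     pfst e \<le> 4 \<and> psnd e = 0 \<or>
     5 \<le> pfst e \<and> pfst e \<le> 7 \<and> pfst (psnd e) \<in> S \<and> psnd (psnd e) \<in> S \<or>
     pfst e = 8 \<and> psnd e \<in> S"

lemma mono_program_rule: "mono program_rule"
  by (intro monoI le_funI le_boolI) (auto simp: program_rule_def)

lemma decidable_program_rule: "decidable2 A (\<lambda>w e. program_rule (set_decode w) e)"
  unfolding program_rule_def by (intro computable_intros)

lemma psnd_less: "pfst e \<noteq> 0 \<Longrightarrow> psnd e < e"
proof -
  assume "pfst e \<noteq> 0"
  then have "psnd e < prod_encode (pfst e, psnd e)"
    by (cases "pfst e") (auto simp: prod_encode_def)
  then show ?thesis by simp
qed

lemma program_rule_sound: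
  assumes "certificate program_rule w"
  shows "e \<in> set_decode w \<Longrightarrow> e \<in> range code_num"
proof (induction e rule: less_induct)
  case (less e)
  have e: "e = prod_encode (pfst e, prod_encode (pfst (psnd e), psnd (psnd e)))" by simp
  have "program_rule (set_decode w) e" using assms less.prems unfolding certificate_def by blast
  then consider (leaf) "pfst e \<le> 4" "psnd e = 0"
    | (binary) "5 \<le> pfst e" "pfst e \<le> 7"
        "pfst (psnd e) \<in> set_decode w" "psnd (psnd e) \<in> set_decode w"
    | (search) "pfst e = 8" "psnd e \<in> set_decode w"
    unfolding program_rule_def by argo
  then show ?case
  proof cases
    case leaf
    then consider "pfst e = 0" | "pfst e = 1" | "pfst e = 2" | "pfst e = 3" | "pfst e = 4"
      by linarith
    then have "e \<in> {code_num Zero, code_num Succ, code_num Left, code_num Right, code_num Query}"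
      by cases (use leaf(2) prod_encode_pfst_psnd[of e] in auto)
    then show ?thesis by blast
  next
    case binary
    then have "pfst (psnd e) < e" "psnd (psnd e) < e"
      using psnd_less[of e] pfst_le[of "psnd e"] psnd_le[of "psnd e"] by linarith+
    then obtain p q where "pfst (psnd e) = code_num p" "psnd (psnd e) = code_num q"
      using less.IH binary by blast
    moreover consider "pfst e = 5" | "pfst e = 6" | "pfst e = 7" using binary by linarith
    ultimately have "e \<in> {code_num (Tuple p q), code_num (Comp p q), code_num (PrimRec p q)}"
      using e by (metis code_num.simps(6,7,8) insertCI)
    then show ?thesis by blast
  next
    case search
    then obtain p where "psnd e = code_num p" using less.IH[of "psnd e"] psnd_less[of e] by auto
    then have "e = code_num (Search p)" using search(1) prod_encode_pfst_psnd[of e] by simp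
    then show ?thesis by blast
  qed
qed

lemma certified_program_leaf: "t \<le> 4 \<Longrightarrow> certified program_rule (prod_encode (t, 0))"
  by (rule certified_rule[OF mono_program_rule, of "{}"]) (simp, simp add: program_rule_def, simp)

lemma certified_program_binary:
  assumes "5 \<le> t" "t \<le> 7" and "certified program_rule e" "certified program_rule e'"
  shows "certified program_rule (prod_encode (t, prod_encode (e, e')))"
  by (rule certified_rule[OF mono_program_rule, of "{e, e'}"])
    (simp, simp add: program_rule_def assms, use assms in blast)

lemma certified_program_search:
  assumes "certified program_rule e"
  shows "certified program_rule (prod_encode (8, e))"
  by (rule certified_rule[OF mono_program_rule, of "{e}"])
    (simp, simp add: program_rule_def, use assms in blast)

lemma certified_program_complete: "certified program_rule (code_num p)"
  by (induction p)
    (simp_all add: certified_program_leaf certified_program_binary certified_program_search)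

lemma certified_program_iff: "certified program_rule e \<longleftrightarrow> e \<in> range code_num"
  using certified_program_complete program_rule_sound unfolding certified_def by blast

definition halts_by :: "nat \<Rightarrow> nat \<Rightarrow> bool" where
  "halts_by n z \<longleftrightarrow> certified_below program_rule n (pfst z) \<and>
     (\<exists>y<n. certified_below eval_rule n (triple (pfst z) (psnd z) y))"

lemma mem_halting_problem_iff:
  "z \<in> halting_problem \<longleftrightarrow> (\<exists>p. pfst z = code_num p \<and> run {} p (psnd z) \<noteq> None)"
proof
  assume "\<exists>p. pfst z = code_num p \<and> run {} p (psnd z) \<noteq> None"
  then obtain p where "z = prod_encode (code_num p, psnd z)" "run {} p (psnd z) \<noteq> None"
    by (metis prod_encode_pfst_psnd)
  then show "z \<in> halting_problem" unfolding halting_problem_def by blast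
qed (auto simp: halting_problem_def)

lemma run_eq_if_code_num_eq:
  assumes "code_num p = code_num q"
  shows "run {} p x = run {} q x"
proof -
  have "run {} p x = Some y \<longleftrightarrow> run {} q x = Some y" for y
    using assms by (simp flip: certified_eval_iff_run)
  then show ?thesis by (metis option.exhaust)
qed

lemma prod_encode_mem_halting_problem_iff:
  "prod_encode (code_num p, x) \<in> halting_problem \<longleftrightarrow> run {} p x \<noteq> None"
  unfolding mem_halting_problem_iff pfst_prod_encode psnd_prod_encode
  by (metis run_eq_if_code_num_eq)

lemma halts_by_mono: "halts_by n z \<Longrightarrow> n \<le> n' \<Longrightarrow> halts_by n' z"
  unfolding halts_by_def using certified_below_mono order_less_le_trans by meson

lemma halting_problem_iff_halts_by: "z \<in> halting_problem \<longleftrightarrow> (\<exists>n. halts_by n z)"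
proof -
  have "z \<in> halting_problem \<longleftrightarrow>
      certified program_rule (pfst z) \<and> (\<exists>y. certified eval_rule (triple (pfst z) (psnd z) y))"
    unfolding mem_halting_problem_iff certified_program_iff using certified_eval_iff_run by auto
  also have "\<dots> \<longleftrightarrow> (\<exists>n. halts_by n z)"
  proof
    assume "certified program_rule (pfst z) \<and> (\<exists>y. certified eval_rule (triple (pfst z) (psnd z) y))"
    then obtain k l y where "certified_below program_rule k (pfst z)"
      "certified_below eval_rule l (triple (pfst z) (psnd z) y)"
      unfolding certified_iff_below by blast
    then have "halts_by (k + l + Suc y) z"
      unfolding halts_by_def by (auto elim!: certified_below_mono intro!: exI[of _ y])
    then show "\<exists>n. halts_by n z" by blast
  qed (auto simp: halts_by_def certified_iff_below)
  finally show ?thesis .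
qed

lemma eventually_halts_by: "\<forall>\<^sub>F n in sequentially. halts_by n z \<longleftrightarrow> z \<in> halting_problem"
proof (cases "z \<in> halting_problem")
  case True
  then obtain n where "halts_by n z" using halting_problem_iff_halts_by by blast
  then show ?thesis using True halts_by_mono eventually_sequentially by auto
next
  case False
  then show ?thesis using halting_problem_iff_halts_by by auto
qed

lemma decidable_halts_by: "decidable2 A halts_by"
  unfolding halts_by_def
  by (intro computable_intros decidable_comp2[OF decidable_certified_below[OF decidable_eval_rule]]
      decidable_comp2[OF decidable_certified_below[OF decidable_program_rule]])

lemma decidable_halting_problem_ex:
  assumes "decidable2 {} R"
  shows "decidable halting_problem (\<lambda>x. \<exists>m. R x m)"
proof -
  obtain p where p: "\<And>z. run {} p z = Some (of_bool (\<not> R (pfst z) (psnd z)))"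
    using decidable_not[OF assms] unfolding decidable_def computable_def by blast
  have mem_iff: "prod_encode (code_num (Search p), x) \<in> halting_problem \<longleftrightarrow> (\<exists>m. R x m)" for x
    unfolding prod_encode_mem_halting_problem_iff
    by (subst run_Search_total[of _ _ _ "\<lambda>m. of_bool (\<not> R x m)"]) (simp_all add: p)
  have "decidable halting_problem (\<lambda>z. z \<in> halting_problem)"
    unfolding decidable_def computable_def by (rule exI[of _ Query]) simp
  then have "decidable halting_problem (\<lambda>x. prod_encode (code_num (Search p), x) \<in> halting_problem)"
    by (rule decidable_comp) (intro computable_intros)
  then show ?thesis unfolding mem_iff .
qed

section \<open>Limit computability\<close>

definition limit_computable :: "nat set \<Rightarrow> (nat \<Rightarrow> nat option) \<Rightarrow> bool" where
  "limit_computable A \<phi> \<longleftrightarrow>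
     (\<exists>f. computable2 A f \<and> (\<forall>x y. \<phi> x = Some y \<longrightarrow> (\<forall>\<^sub>F n in sequentially. f x n = y)))"

lemma limit_computableI:
  assumes "computable2 A f" "\<And>x y. \<phi> x = Some y \<Longrightarrow> \<forall>\<^sub>F n in sequentially. f x n = y"
  shows "limit_computable A \<phi>"
  using assms unfolding limit_computable_def by blast

lemma limit_computable_of_computable:
  assumes "computable A f" "\<And>x. \<phi> x = Some (f x)"
  shows "limit_computable A \<phi>"
  using assms computable_comp[OF assms(1) computable_pfst[OF computable_id]]
  by (intro limit_computableI[where f = "\<lambda>x n. f x"]) auto

lemma limit_computable_Tuple:
  assumes "limit_computable A (run B p)" "limit_computable A (run B q)"
  shows "limit_computable A (run B (Tuple p q))"
proof -
  obtain f where f: "computable2 A f" "\<And>x y. run B p x = Some y \<Longrightarrow> \<forall>\<^sub>F n in sequentially. f x n = y"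
    using assms(1) unfolding limit_computable_def by blast
  obtain g where g: "computable2 A g" "\<And>x y. run B q x = Some y \<Longrightarrow> \<forall>\<^sub>F n in sequentially. g x n = y"
    using assms(2) unfolding limit_computable_def by blast
  show ?thesis
  proof (rule limit_computableI)
    show "computable2 A (\<lambda>x n. prod_encode (f x n, g x n))" by (intro computable_pair f g)
    fix x y assume "run B (Tuple p q) x = Some y"
    then obtain u v where "run B p x = Some u" "run B q x = Some v" and y: "y = prod_encode (u, v)"
      by (auto simp: bind_eq_Some_conv)
    from f(2)[OF this(1)] g(2)[OF this(2)]
    show "\<forall>\<^sub>F n in sequentially. prod_encode (f x n, g x n) = y"
      by eventually_elim (simp add: y)
  qed
qed

lemma limit_computable_Comp:
  assumes "limit_computable A (run B p)" "limit_computable A (run B q)"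
  shows "limit_computable A (run B (Comp p q))"
proof -
  obtain f where f: "computable2 A f" "\<And>x y. run B p x = Some y \<Longrightarrow> \<forall>\<^sub>F n in sequentially. f x n = y"
    using assms(1) unfolding limit_computable_def by blast
  obtain g where g: "computable2 A g" "\<And>x y. run B q x = Some y \<Longrightarrow> \<forall>\<^sub>F n in sequentially. g x n = y"
    using assms(2) unfolding limit_computable_def by blast
  show ?thesis
  proof (rule limit_computableI)
    show "computable2 A (\<lambda>x n. f (g x n) n)"
      by (intro computable_comp2[OF f(1)] computable_intros g)
    fix x y assume "run B (Comp p q) x = Some y"
    then obtain u where "run B q x = Some u" "run B p u = Some y"
      by (auto simp: bind_eq_Some_conv)
    from g(2)[OF this(1)] f(2)[OF this(2)] show "\<forall>\<^sub>F n in sequentially. f (g x n) n = y"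
      by eventually_elim simp
  qed
qed

lemma limit_computable_PrimRec:
  assumes "limit_computable A (run B p)" "limit_computable A (run B q)"
  shows "limit_computable A (run B (PrimRec p q))"
proof -
  obtain f where f: "computable2 A f" "\<And>x y. run B p x = Some y \<Longrightarrow> \<forall>\<^sub>F n in sequentially. f x n = y"
    using assms(1) unfolding limit_computable_def by blast
  obtain g where g: "computable2 A g" "\<And>x y. run B q x = Some y \<Longrightarrow> \<forall>\<^sub>F n in sequentially. g x n = y"
    using assms(2) unfolding limit_computable_def by blast
  define h where "h x n = rec_nat (f (pfst x) n)
    (\<lambda>k r. g (prod_encode (pfst x, prod_encode (k, r))) n) (psnd x)" for x n
  show ?thesis
  proof (rule limit_computableI)
    show "computable2 A h" unfolding h_def
      by (intro computable_rec_nat computable_comp2[OF f(1)] computable_comp2[OF g(1)]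
          computable_intros)
    have "\<forall>\<^sub>F n in sequentially. h (prod_encode (a, m)) n = y"
      if "run B (PrimRec p q) (prod_encode (a, m)) = Some y" for a m y
      using that
    proof (induction m arbitrary: y)
      case 0
      then have "run B p a = Some y" by simp
      from f(2)[OF this] show ?case by eventually_elim (simp add: h_def)
    next
      case (Suc m)
      then obtain v where v: "run B (PrimRec p q) (prod_encode (a, m)) = Some v"
        "run B q (prod_encode (a, prod_encode (m, v))) = Some y"
        by (auto simp: bind_eq_Some_conv)
      from Suc.IH[OF v(1)] g(2)[OF v(2)] show ?case
        by eventually_elim (simp add: h_def)
    qed
    from this[of "pfst x" "psnd x" for x]
    show "\<forall>\<^sub>F n in sequentially. h x n = y" if "run B (PrimRec p q) x = Some y" for x y
      using that by simp
  qed
qed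

lemma limit_computable_Search:
  assumes "limit_computable A (run B p)"
  shows "limit_computable A (run B (Search p))"
proof -
  obtain f where f: "computable2 A f" "\<And>x y. run B p x = Some y \<Longrightarrow> \<forall>\<^sub>F n in sequentially. f x n = y"
    using assms unfolding limit_computable_def by blast
  \<comment> \<open>The sum counts the candidates below \<open>n\<close> up to which no zero has been seen, so it equals the
    least zero if there is one below \<open>n\<close>.\<close>
  define h :: "nat \<Rightarrow> nat \<Rightarrow> nat" where
    "h x n = (\<Sum>k<n. of_bool (\<forall>m<Suc k. f (prod_encode (x, m)) n \<noteq> 0))" for x n
  have "decidable A (\<lambda>z. \<forall>m<Suc (psnd z). f (prod_encode (pfst (pfst z), m)) (psnd (pfst z)) \<noteq> 0)"
    by (intro computable_intros computable_comp2[OF f(1)])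
  then have "computable2 A h"
    unfolding h_def decidable_def by (intro computable_sum computable_intros)
  moreover have "\<forall>\<^sub>F n in sequentially. h x n = y" if "run B (Search p) x = Some y" for x y
  proof -
    have zero: "run B p (prod_encode (x, y)) = Some 0"
      and nonzero: "\<And>k. k < y \<Longrightarrow> \<exists>v. run B p (prod_encode (x, k)) = Some (Suc v)"
      using that unfolding run_Search_eq_Some_iff by auto
    have "\<forall>\<^sub>F n in sequentially. f (prod_encode (x, k)) n \<noteq> 0" if "k < y" for k
    proof -
      obtain v where "run B p (prod_encode (x, k)) = Some (Suc v)" using nonzero \<open>k < y\<close> by blast
      from f(2)[OF this] show ?thesis by eventually_elim simp
    qed
    then have "\<forall>\<^sub>F n in sequentially. \<forall>k\<in>{..<y}. f (prod_encode (x, k)) n \<noteq> 0"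
      by (intro eventually_ball_finite) auto
    with f(2)[OF zero] eventually_ge_at_top[of y] show ?thesis
    proof eventually_elim
      case (elim n)
      then have "(\<forall>m<Suc k. f (prod_encode (x, m)) n \<noteq> 0) \<longleftrightarrow> k < y" for k
        by (metis lessThan_iff less_Suc_eq_le not_less order_le_less_trans)
      then have "h x n = card ({..<n} \<inter> {k. k < y})" by (simp add: h_def sum_of_bool_eq)
      also have "{..<n} \<inter> {k. k < y} = {..<y}" using elim by auto
      finally show ?case by simp
    qed
  qed
  ultimately show ?thesis by (rule limit_computableI)
qed

lemma limit_computable_run:
  assumes "limit_computable A (run B Query)"
  shows "limit_computable A (run B p)"
proof (induction p)
  case Zero
  show ?case by (rule limit_computable_of_computable[of _ "\<lambda>x. 0"]) (intro computable_intros, simp)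
next
  case Succ
  show ?case by (rule limit_computable_of_computable[of _ Suc]) (intro computable_intros, simp)
next
  case Left
  show ?case
    by (rule limit_computable_of_computable[of _ pfst]) (intro computable_intros, simp add: pfst_def)
next
  case Right
  show ?case
    by (rule limit_computable_of_computable[of _ psnd]) (intro computable_intros, simp add: psnd_def)
qed (rule assms limit_computable_Tuple limit_computable_Comp limit_computable_PrimRec
    limit_computable_Search; assumption)+

lemma limit_lemma:
  assumes "computable halting_problem f"
  obtains g where "computable2 {} g" "\<And>x. \<forall>\<^sub>F n in sequentially. g x n = f x"
proof -
  obtain p where p: "\<And>x. run halting_problem p x = Some (f x)"
    using assms unfolding computable_def by blast
  have "limit_computable {} (run halting_problem Query)"
  proof (rule limit_computableI)
    show "computable2 {} (\<lambda>x n. of_bool (halts_by n x))"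
      using decidable_comp2[OF decidable_halts_by, of "{}" psnd pfst]
      by (simp add: decidable_def computable_intros)
    show "\<forall>\<^sub>F n in sequentially. of_bool (halts_by n x) = y"
      if "run halting_problem Query x = Some y" for x y :: nat
      using eventually_halts_by[of x] by eventually_elim (use that in auto)
  qed
  then have "limit_computable {} (run halting_problem p)" by (rule limit_computable_run)
  then show ?thesis using p that unfolding limit_computable_def by blast
qed

section \<open>Binary strings\<close>

text \<open>Heap numbering: the root is \<open>0\<close> and the sons of \<open>i\<close> are \<open>2 * i + 1\<close> and \<open>2 * i + 2\<close>.\<close>

definition node :: "bool list \<Rightarrow> nat" where
  "node x = foldl (\<lambda>i b. 2 * i + 1 + of_bool b) 0 x"

fun string_of :: "nat \<Rightarrow> bool list" where
  "string_of 0 = []"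
| "string_of (Suc i) = string_of (i div 2) @ [odd i]"

lemma node_Nil [simp]: "node [] = 0"
  and node_snoc [simp]: "node (x @ [b]) = 2 * node x + 1 + of_bool b"
  by (simp_all add: node_def)

lemma string_of_node [simp]: "string_of (node x) = x"
proof (induction x rule: rev_induct)
  case (snoc b x)
  then show ?case by (cases b) simp_all
qed simp

lemma node_string_of [simp]: "node (string_of i) = i"
proof (induction i rule: string_of.induct)
  case (2 i)
  then show ?case by (cases "even i") (auto elim!: evenE oddE)
qed simp

lemma inj_string_of: "inj string_of"
  by (metis injI node_string_of)

lemma Suc_node_less: "Suc (node x) < 2 ^ Suc (length x)"
proof (induction x rule: rev_induct)
  case (snoc b x)
  then show ?case by (cases b) simp_all
qed simp

lemma string_encode_simps [simp]:
  "string_encode [] = 0"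
  "string_encode (b # x) = Suc (prod_encode (of_bool b, string_encode x))"
  by (simp_all add: string_encode_def)

lemma string_encode_inject: "string_encode x = string_encode y \<longleftrightarrow> x = y"
proof -
  have "inj (of_bool :: bool \<Rightarrow> nat)" by (simp add: inj_def)
  then show ?thesis by (simp add: string_encode_def list_encode_eq inj_map_eq_map)
qed

lemma length_le_string_encode: "length x \<le> string_encode x"
proof (induction x)
  case (Cons b x)
  then show ?case using le_prod_encode_2[of "string_encode x" "of_bool b"] by simp
qed simp

lemma computable_string_encode_string_of: "computable A (\<lambda>i. string_encode (string_of i))"
proof -
  \<comment> \<open>One step moves the last letter of the string with number \<open>pfst r\<close> to the front of the string
    with code \<open>psnd r\<close>.\<close>
  define step where "step r = (if pfst r = 0 then r else prod_encode ((pfst r - 1) div 2,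
    Suc (prod_encode (if even (pfst r - 1) then 0 else 1, psnd r))))" for r
  have step_0: "(step ^^ m) (prod_encode (0, c)) = prod_encode (0, c)" for m c
    by (induction m) (simp_all add: step_def)
  have step_Suc: "step (prod_encode (Suc i, string_encode y)) =
      prod_encode (i div 2, string_encode (odd i # y))" for i y
    by (simp add: step_def)
  have "(step ^^ m) (prod_encode (i, string_encode y)) =
      prod_encode (0, string_encode (string_of i @ y))" if "i \<le> m" for i m y
    using that
  proof (induction m arbitrary: i y)
    case (Suc m)
    show ?case
    proof (cases i)
      case 0
      then show ?thesis by (simp add: step_0 del: funpow.simps)
    next
      case (Suc j)
      then have "j div 2 \<le> m" using Suc.prems by linarith
      then show ?thesis unfolding funpow_Suc_right Suc comp_apply step_Suc
        by (simp add: Suc.IH del: string_encode_simps)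
    qed
  qed simp
  from this[of i i "[]" for i]
  have "psnd ((step ^^ i) (prod_encode (i, 0))) = string_encode (string_of i)" for i by simp
  moreover have "computable A step" unfolding step_def[abs_def] by (intro computable_intros)
  then have "computable A (\<lambda>i. psnd ((step ^^ i) (prod_encode (i, 0))))"
    by (intro computable_funpow computable_intros)
  ultimately show ?thesis by simp
qed

lemma computable_node_of_code:
  obtains f where "computable A f" "\<And>x. f (string_encode x) = node x"
proof
  let ?F = "\<lambda>c i. if string_encode (string_of i) = c then i else 0"
  define f where "f c = max_below (?F c) (2 ^ Suc c)" for c
  show "computable A f" unfolding f_def
    by (intro computable_intros computable_comp[OF computable_string_encode_string_of])
  show "f (string_encode x) = node x" for x
  proof (rule antisym)
    have "i = node x" if "string_encode (string_of i) = string_encode x" for i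
      using that string_encode_inject node_string_of by metis
    then show "f (string_encode x) \<le> node x" by (simp add: f_def max_below_le_iff)
    have "node x < 2 ^ Suc (length x)" using Suc_node_less[of x] by linarith
    also have "\<dots> \<le> 2 ^ Suc (string_encode x)"
      using length_le_string_encode by (intro power_increasing) auto
    finally show "node x \<le> f (string_encode x)"
      using max_below_ge[of "node x" _ "?F (string_encode x)"] by (simp add: f_def)
  qed
qed

text \<open>
  In heap numbering \<open>Suc i\<close> is a \<open>1\<close> followed by the bits of the string, so prefixes arise by cutting
  off binary digits.
\<close>

lemma prefix_string_of_iff:
  "prefix (string_of i) (string_of j) \<longleftrightarrow> (\<exists>k<Suc j. Suc j div 2 ^ k = Suc i)"
proof -
  have "prefix (string_of i) (string_of j) \<longleftrightarrow> (\<exists>k. Suc j div 2 ^ k = Suc i)"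
  proof (induction j rule: string_of.induct)
    case 1
    have "Suc 0 div 2 ^ k \<le> Suc 0" for k by (rule div_le_dividend)
    then have "(\<exists>k. Suc 0 div 2 ^ k = Suc i) \<longleftrightarrow> i = 0"
      by (metis Suc_le_mono div_by_1 le_zero_eq power_0)
    moreover have "string_of i = [] \<longleftrightarrow> i = 0" by (cases i) auto
    ultimately show ?case by simp
  next
    case (2 j)
    have "(\<exists>k. Suc (Suc j) div 2 ^ k = Suc i) \<longleftrightarrow>
        Suc (Suc j) div 2 ^ 0 = Suc i \<or> (\<exists>k. Suc (Suc j) div 2 ^ Suc k = Suc i)"
      by (metis not0_implies_Suc)
    also have "(\<exists>k. Suc (Suc j) div 2 ^ Suc k = Suc i) \<longleftrightarrow> (\<exists>k. Suc (j div 2) div 2 ^ k = Suc i)"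
      by (simp add: div_mult2_eq)
    also have "Suc (Suc j) div 2 ^ 0 = Suc i \<longleftrightarrow> string_of i = string_of (Suc j)"
      by (metis node_string_of div_by_1 power_0 nat.inject)
    finally show ?case using "2.IH" by simp
  qed
  moreover have "k < Suc j" if "Suc j div 2 ^ k = Suc i" for k
  proof (rule ccontr)
    assume "\<not> k < Suc j"
    then have "Suc j < 2 ^ k" using less_exp[of k] by linarith
    then show False using that by simp
  qed
  ultimately show ?thesis by blast
qed

lemma decidable_prefix [computable_intros]:
  assumes "computable A f" "computable A g"
  shows "decidable A (\<lambda>x. prefix (string_of (f x)) (string_of (g x)))"
  unfolding prefix_string_of_iff by (intro computable_intros assms assms[THEN computable_comp])

definition string_set :: "nat \<Rightarrow> bool list set" where
  "string_set w = string_of ` set_decode w"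

lemma string_set_set_encode: "finite W \<Longrightarrow> string_set (set_encode (node ` W)) = W"
  by (simp add: string_set_def image_image)

lemma sum_string_set: "(\<Sum>y\<in>string_set w. f y) = (\<Sum>i\<in>set_decode w. f (string_of i))"
  unfolding string_set_def by (subst sum.reindex) (auto intro: inj_on_subset[OF inj_string_of])

lemma computable_sum_string_set:
  assumes "computable2 A (\<lambda>x i. F x (string_of i))" "computable A g"
  shows "computable A (\<lambda>x. \<Sum>y\<in>string_set (g x). F x y)"
  unfolding sum_string_set by (intro computable_intros assms)

section \<open>Semimeasures and prefix-free sets\<close>

abbreviation prefix_free :: "'a list set \<Rightarrow> bool" where
  "prefix_free \<equiv> pairwise (\<parallel>)"

definition prefix_free_above :: "'a list \<Rightarrow> 'a list set set" where
  "prefix_free_above x = {W. finite W \<and> prefix_free W \<and> (\<forall>y\<in>W. prefix x y)}"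

lemma empty_prefix_free_above [simp]: "{} \<in> prefix_free_above x"
  and singleton_prefix_free_above [simp]: "{x} \<in> prefix_free_above x"
  by (simp_all add: prefix_free_above_def pairwise_insert)

lemma prefix_free_above_subset: "W \<in> prefix_free_above x \<Longrightarrow> V \<subseteq> W \<Longrightarrow> V \<in> prefix_free_above x"
  unfolding prefix_free_above_def by (auto intro: finite_subset pairwise_subset)

lemma prefix_free_above_mono: "prefix x y \<Longrightarrow> prefix_free_above y \<subseteq> prefix_free_above x"
  unfolding prefix_free_above_def using prefix_order.trans by blast

lemma filter_prefix_free_above: "W \<in> prefix_free_above x \<Longrightarrow> {y \<in> W. prefix z y} \<in> prefix_free_above z"
  unfolding prefix_free_above_def by (auto intro: pairwise_subset)

lemma Un_prefix_free_above:
  assumes "x \<parallel> y" "prefix z x" "prefix z y"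
    and V: "V \<in> prefix_free_above x" and W: "W \<in> prefix_free_above y"
  shows "V \<union> W \<in> prefix_free_above z" and "V \<inter> W = {}"
proof -
  have parallel: "u \<parallel> v" if "u \<in> V" "v \<in> W" for u v
  proof -
    have "prefix x u" "prefix y v" using V W that unfolding prefix_free_above_def by auto
    then show ?thesis using \<open>x \<parallel> y\<close> parallel_append by (metis prefixE)
  qed
  then have "prefix_free (V \<union> W)"
    using V W unfolding prefix_free_above_def pairwise_def
    by (blast intro: parallel_commute[THEN iffD1])
  moreover have "V \<in> prefix_free_above z" "W \<in> prefix_free_above z"
    using V W assms(2,3) prefix_free_above_mono by blast+
  ultimately show "V \<union> W \<in> prefix_free_above z" unfolding prefix_free_above_def by blast
  show "V \<inter> W = {}" using parallel by blast
qed

lemma decidable_string_set_prefix_free_above [computable_intros]: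
  assumes "computable A f" "computable A g"
  shows "decidable A (\<lambda>x. string_set (g x) \<in> prefix_free_above (string_of (f x)))"
proof -
  have "string_set w \<in> prefix_free_above (string_of i) \<longleftrightarrow>
      (\<forall>j\<in>set_decode w. prefix (string_of i) (string_of j)) \<and>
      (\<forall>j\<in>set_decode w. \<forall>k\<in>set_decode w. \<not> j = k \<longrightarrow>
        \<not> prefix (string_of j) (string_of k) \<and> \<not> prefix (string_of k) (string_of j))" for i w
    unfolding prefix_free_above_def pairwise_def parallel_def string_set_def
    by (auto simp: inj_eq[OF inj_string_of])
  then show ?thesis
    by (simp only:) (intro computable_intros assms assms[THEN computable_comp])
qed

lemma decidable_string_set_prefix_free_above_Nil [computable_intros]:
  "computable A g \<Longrightarrow> decidable A (\<lambda>x. string_set (g x) \<in> prefix_free_above [])"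
  using decidable_string_set_prefix_free_above[OF computable_const[of A 0]] by simp

lemma ball_prefix_free_above_iff:
  "(\<forall>W\<in>prefix_free_above x. P W) \<longleftrightarrow> (\<forall>w. string_set w \<in> prefix_free_above x \<longrightarrow> P (string_set w))"
proof -
  have "\<exists>w. W = string_set w" if "W \<in> prefix_free_above x" for W
    using that string_set_set_encode unfolding prefix_free_above_def by blast
  then show ?thesis by metis
qed

lemma prefix_snoc_cases:
  assumes "prefix x y" "x \<noteq> y"
  obtains b where "prefix (x @ [b]) y"
proof -
  obtain zs where "y = x @ zs" "zs \<noteq> []" using assms by (auto simp: prefix_def)
  then obtain b zs' where "y = (x @ [b]) @ zs'" by (cases zs) auto
  then show thesis using that prefixI by blast
qed

lemma parallel_snoc: "a \<noteq> b \<Longrightarrow> x @ [a] \<parallel> x @ [b]"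
  by (simp add: parallel_def)

lemma sum_prefix_free_above_snoc:
  fixes x :: "bool list"
  assumes W: "W \<in> prefix_free_above x" "x \<notin> W"
  shows "sum f W = sum f {y \<in> W. prefix (x @ [False]) y} + sum f {y \<in> W. prefix (x @ [True]) y}"
proof -
  define V where "V b = {y \<in> W. prefix (x @ [b]) y}" for b
  have V: "V b \<in> prefix_free_above (x @ [b])" for b
    unfolding V_def using W(1) by (rule filter_prefix_free_above)
  have "\<exists>b. y \<in> V b" if "y \<in> W" for y
  proof -
    have "prefix x y" "x \<noteq> y" using W that unfolding prefix_free_above_def by blast+
    then show ?thesis using that unfolding V_def by (auto elim: prefix_snoc_cases)
  qed
  then have "W = V False \<union> V True" unfolding ex_bool_eq by (auto simp: V_def)
  moreover have "V False \<inter> V True = {}"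
    by (rule Un_prefix_free_above(2)[OF parallel_snoc prefixI[OF refl] prefixI[OF refl] V V]) simp
  moreover have "finite (V b)" for b using V unfolding prefix_free_above_def by blast
  ultimately show ?thesis unfolding V_def[symmetric] by (metis sum.union_disjoint)
qed

lemma semimeasure_sum_le:
  assumes m: "semimeasure m" and W: "W \<in> prefix_free_above x"
  shows "sum m W \<le> m x"
proof -
  have "finite W" using W unfolding prefix_free_above_def by blast
  then obtain d where "\<forall>y\<in>W. length y \<le> length x + d"
    by (metis finite_imageI finite_nat_set_iff_bounded_le image_eqI trans_le_add2)
  then show ?thesis using W
  proof (induction d arbitrary: x W)
    case 0
    have "prefix x y" if "y \<in> W" for y using 0 that unfolding prefix_free_above_def by blast
    then have "y = x" if "y \<in> W" for y using 0 that by (fastforce elim!: prefixE)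
    then consider "W = {}" | "W = {x}" by blast
    then show ?case using m by cases (auto simp: semimeasure_def)
  next
    case (Suc d)
    show ?case
    proof (cases "x \<in> W")
      case True
      then have "W = {x}" using Suc.prems(2) unfolding prefix_free_above_def pairwise_def by blast
      then show ?thesis by simp
    next
      case False
      let ?V = "\<lambda>b. {y \<in> W. prefix (x @ [b]) y}"
      have V_le: "sum m (?V b) \<le> m (x @ [b])" for b
      proof (rule Suc.IH)
        show "?V b \<in> prefix_free_above (x @ [b])"
          using Suc.prems(2) by (rule filter_prefix_free_above)
      qed (use Suc.prems(1) in auto)
      have "sum m W = sum m (?V False) + sum m (?V True)"
        using Suc.prems(2) False by (rule sum_prefix_free_above_snoc)
      also have "\<dots> \<le> m (x @ [False]) + m (x @ [True])"
        by (intro add_mono V_le)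
      also have "\<dots> \<le> m x" using m unfolding semimeasure_def by blast
      finally show ?thesis .
    qed
  qed
qed

definition kraft_inequality :: "('a list \<Rightarrow> real) \<Rightarrow> bool" where
  "kraft_inequality g \<longleftrightarrow> (\<forall>W\<in>prefix_free_above []. sum g W \<le> 1)"

lemma kraft_inequality_mono:
  assumes "kraft_inequality g" "\<And>y. f y \<le> g y"
  shows "kraft_inequality f"
  using assms unfolding kraft_inequality_def by (meson order_trans sum_mono)

lemma kraft_inequality_sum_le_1:
  "kraft_inequality g \<Longrightarrow> W \<in> prefix_free_above x \<Longrightarrow> sum g W \<le> 1"
  unfolding kraft_inequality_def using prefix_free_above_mono[OF Nil_prefix] by blast

lemma kraft_inequality_semimeasure:
  assumes "semimeasure m"
  shows "kraft_inequality m"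
  unfolding kraft_inequality_def
proof
  fix W assume "W \<in> prefix_free_above ([] :: bool list)"
  with assms have "sum m W \<le> m []" by (rule semimeasure_sum_le)
  also have "\<dots> \<le> 1" using assms unfolding semimeasure_def by blast
  finally show "sum m W \<le> 1" .
qed

definition semimeasure_hull :: "(bool list \<Rightarrow> real) \<Rightarrow> bool list \<Rightarrow> real" where
  "semimeasure_hull g x = (SUP W\<in>prefix_free_above x. sum g W)"

lemma sum_le_semimeasure_hull:
  assumes "kraft_inequality g" "W \<in> prefix_free_above x"
  shows "sum g W \<le> semimeasure_hull g x"
  unfolding semimeasure_hull_def using assms(2)
proof (rule cSUP_upper)
  show "bdd_above (sum g ` prefix_free_above x)"
    using kraft_inequality_sum_le_1[OF assms(1)] by (rule bdd_aboveI2)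
qed

lemma semimeasure_hull_ge: "kraft_inequality g \<Longrightarrow> g x \<le> semimeasure_hull g x"
  using sum_le_semimeasure_hull[OF _ singleton_prefix_free_above] by fastforce

lemma cSUP_add_le:
  fixes f :: "'a \<Rightarrow> real" and g :: "'b \<Rightarrow> real"
  assumes "I \<noteq> {}" "J \<noteq> {}" "\<And>i j. i \<in> I \<Longrightarrow> j \<in> J \<Longrightarrow> f i + g j \<le> c"
  shows "(SUP i\<in>I. f i) + (SUP j\<in>J. g j) \<le> c"
proof -
  have "(SUP j\<in>J. g j) \<le> c - f i" if "i \<in> I" for i
    using assms(2,3) that by (intro cSUP_least) (auto simp: algebra_simps)
  then have "(SUP i\<in>I. f i) \<le> c - (SUP j\<in>J. g j)"
    using assms(1) by (intro cSUP_least) (auto simp: algebra_simps)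
  then show ?thesis by simp
qed

lemma semimeasure_semimeasure_hull:
  assumes kraft: "kraft_inequality g"
  shows "semimeasure (semimeasure_hull g)"
  unfolding semimeasure_def
proof (intro conjI allI)
  fix x
  show "0 \<le> semimeasure_hull g x"
    using sum_le_semimeasure_hull[OF kraft empty_prefix_free_above] by simp
  show "semimeasure_hull g x \<le> 1" unfolding semimeasure_hull_def
    using kraft_inequality_sum_le_1[OF kraft] empty_prefix_free_above by (intro cSUP_least) blast+
  show "semimeasure_hull g (x @ [False]) + semimeasure_hull g (x @ [True]) \<le> semimeasure_hull g x"
    unfolding semimeasure_hull_def[of g "x @ _"]
  proof (rule cSUP_add_le)
    fix V W
    assume V: "V \<in> prefix_free_above (x @ [False])" and W: "W \<in> prefix_free_above (x @ [True])"
    have "x @ [False] \<parallel> x @ [True]" by (rule parallel_snoc) simp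
    note Un = Un_prefix_free_above[OF this prefixI[OF refl] prefixI[OF refl] V W]
    then have "sum g V + sum g W = sum g (V \<union> W)"
      using V W unfolding prefix_free_above_def by (simp add: sum.union_disjoint)
    also have "\<dots> \<le> semimeasure_hull g x" using kraft Un(1) by (rule sum_le_semimeasure_hull)
    finally show "sum g V + sum g W \<le> semimeasure_hull g x" .
  qed (use empty_prefix_free_above in blast)+
qed

section \<open>Dyadic approximations\<close>

definition dyadic :: "nat \<Rightarrow> nat \<Rightarrow> real" where
  "dyadic v k = real v / 2 ^ k"

lemma dyadic_0 [simp]: "dyadic 0 k = 0"
  and dyadic_nonneg [simp]: "0 \<le> dyadic v k"
  by (simp_all add: dyadic_def)

lemma dyadic_le_iff: "dyadic v k \<le> dyadic w k \<longleftrightarrow> v \<le> w"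
  by (simp add: dyadic_def divide_le_cancel)

lemma dyadic_le_1_iff: "dyadic v k \<le> 1 \<longleftrightarrow> v \<le> 2 ^ k"
proof -
  have "dyadic v k \<le> 1 \<longleftrightarrow> real v \<le> real (2 ^ k)" by (simp add: dyadic_def)
  then show ?thesis by (simp only: of_nat_le_iff)
qed

lemma dyadic_max: "dyadic (max v w) k = max (dyadic v k) (dyadic w k)"
  by (auto simp: max_def dyadic_le_iff)

lemma dyadic_sum: "dyadic (\<Sum>y\<in>W. v y) k = (\<Sum>y\<in>W. dyadic (v y) k)"
  by (simp add: dyadic_def sum_divide_distrib)

lemma dyadic_rescale: "k \<le> s \<Longrightarrow> dyadic (v * 2 ^ (s - k)) s = dyadic v k"
proof -
  assume "k \<le> s"
  then have "(2::real) ^ s = 2 ^ (s - k) * 2 ^ k" by (simp flip: power_add)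
  then show ?thesis by (simp add: dyadic_def)
qed

lemma dyadic_power: "j \<le> k \<Longrightarrow> dyadic (2 ^ (k - j)) k = (1 / 2) ^ j"
  using dyadic_rescale[of j k 1] by (simp add: dyadic_def power_one_over)

text \<open>Here \<open>V k\<close> stands for \<open>V k / 2 ^ k\<close>, and the maximum is a numerator over \<open>2 ^ s\<close>.\<close>

definition running_max :: "(nat \<Rightarrow> nat) \<Rightarrow> nat \<Rightarrow> nat" where
  "running_max V s = max_below (\<lambda>k. V k * 2 ^ (s - k)) (Suc s)"

lemma computable_running_max [computable_intros]:
  assumes "computable2 A V" "computable A s"
  shows "computable A (\<lambda>x. running_max (V x) (s x))"
  unfolding running_max_def
  by (intro computable_intros computable_comp2[OF assms(1)] computable_comp[OF assms(2)] assms(2))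

lemma dyadic_running_max_le_iff: "dyadic (running_max V s) s \<le> c \<longleftrightarrow> (\<forall>k\<le>s. dyadic (V k) k \<le> c)"
proof
  assume max_le: "dyadic (running_max V s) s \<le> c"
  show "\<forall>k\<le>s. dyadic (V k) k \<le> c"
  proof (intro allI impI)
    fix k assume "k \<le> s"
    then have "V k * 2 ^ (s - k) \<le> running_max V s"
      unfolding running_max_def by (intro max_below_ge) simp
    then have "dyadic (V k * 2 ^ (s - k)) s \<le> dyadic (running_max V s) s"
      unfolding dyadic_le_iff .
    then show "dyadic (V k) k \<le> c" using max_le \<open>k \<le> s\<close> by (simp add: dyadic_rescale)
  qed
next
  assume terms_le: "\<forall>k\<le>s. dyadic (V k) k \<le> c"
  obtain k where "k \<le> s" "running_max V s = V k * 2 ^ (s - k)"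
    using max_below_attained[OF zero_less_Suc] unfolding running_max_def less_Suc_eq_le by blast
  then show "dyadic (running_max V s) s \<le> c" using terms_le by (simp add: dyadic_rescale)
qed

lemma dyadic_le_running_max: "k \<le> s \<Longrightarrow> dyadic (V k) k \<le> dyadic (running_max V s) s"
  using dyadic_running_max_le_iff[of V s "dyadic (running_max V s) s"] by simp

lemma running_max_cong:
  assumes "\<And>k. k \<le> s \<Longrightarrow> V k = V' k"
  shows "running_max V s = running_max V' s"
proof -
  have "dyadic (running_max V s) s \<le> c \<longleftrightarrow> dyadic (running_max V' s) s \<le> c" for c
    using assms by (simp add: dyadic_running_max_le_iff)
  then show ?thesis by (metis dyadic_le_iff order_antisym order_refl)
qed

lemma incseq_dyadic_running_max: "incseq (\<lambda>s. dyadic (running_max V s) s)"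
  unfolding incseq_def dyadic_running_max_le_iff
  using dyadic_le_running_max order_trans by blast

lemma running_max_incseq:
  assumes "incseq (\<lambda>k. dyadic (V k) k)"
  shows "running_max V s = V s"
proof -
  have "dyadic (running_max V s) s \<le> dyadic (V s) s"
    using assms unfolding dyadic_running_max_le_iff incseq_def by blast
  moreover have "dyadic (V s) s \<le> dyadic (running_max V s) s" by (rule dyadic_le_running_max) simp
  ultimately show ?thesis by (simp add: dyadic_le_iff)
qed

lemma tendsto_dyadic_running_max:
  assumes bdd: "bdd_above (range (\<lambda>k. dyadic (V k) k))"
  shows "(\<lambda>s. dyadic (running_max V s) s) \<longlonglongrightarrow> (SUP k. dyadic (V k) k)"
proof -
  have le_SUP: "dyadic (running_max V s) s \<le> (SUP k. dyadic (V k) k)" for s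
    unfolding dyadic_running_max_le_iff using bdd by (auto intro: cSUP_upper)
  then have bdd': "bdd_above (range (\<lambda>s. dyadic (running_max V s) s))" by (rule bdd_aboveI2)
  have "(SUP s. dyadic (running_max V s) s) = (SUP k. dyadic (V k) k)"
  proof (rule antisym)
    show "(SUP s. dyadic (running_max V s) s) \<le> (SUP k. dyadic (V k) k)"
      using le_SUP by (intro cSUP_least) auto
    show "(SUP k. dyadic (V k) k) \<le> (SUP s. dyadic (running_max V s) s)"
      using dyadic_le_running_max[OF order_refl] bdd' by (intro cSUP_mono) auto
  qed
  then show ?thesis using LIMSEQ_incseq_SUP[OF bdd' incseq_dyadic_running_max] by simp
qed

text \<open>Negative values of \<open>r\<close> are truncated to \<open>0\<close> by \<^const>\<open>nat\<close>.\<close>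

lemma incseq_dyadic_floor:
  fixes r :: "nat \<Rightarrow> real"
  assumes "incseq r"
  shows "incseq (\<lambda>s. dyadic (nat \<lfloor>2 ^ s * r s\<rfloor>) s)"
proof (rule incseq_SucI)
  fix s
  have "2 * real_of_int \<lfloor>2 ^ s * r s\<rfloor> \<le> 2 * (2 ^ s * r s)" by simp
  also have "\<dots> \<le> 2 ^ Suc s * r (Suc s)" using incseqD[OF assms, of s "Suc s"] by simp
  finally have "2 * \<lfloor>2 ^ s * r s\<rfloor> \<le> \<lfloor>2 ^ Suc s * r (Suc s)\<rfloor>" by (simp add: le_floor_iff)
  then have "nat \<lfloor>2 ^ s * r s\<rfloor> * 2 ^ (Suc s - s) \<le> nat \<lfloor>2 ^ Suc s * r (Suc s)\<rfloor>" by simp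
  then have "dyadic (nat \<lfloor>2 ^ s * r s\<rfloor> * 2 ^ (Suc s - s)) (Suc s)
      \<le> dyadic (nat \<lfloor>2 ^ Suc s * r (Suc s)\<rfloor>) (Suc s)" unfolding dyadic_le_iff .
  then show "dyadic (nat \<lfloor>2 ^ s * r s\<rfloor>) s \<le> dyadic (nat \<lfloor>2 ^ Suc s * r (Suc s)\<rfloor>) (Suc s)"
    unfolding dyadic_rescale[OF le_SucI[OF order_refl]] .
qed

lemma tendsto_dyadic_floor:
  fixes r :: "nat \<Rightarrow> real"
  assumes "r \<longlonglongrightarrow> c" "0 \<le> c"
  shows "(\<lambda>s. dyadic (nat \<lfloor>2 ^ s * r s\<rfloor>) s) \<longlonglongrightarrow> c"
proof (rule tendsto_sandwich)
  have "(\<lambda>s. r s - (1 / 2) ^ s) \<longlonglongrightarrow> c - 0"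
    by (intro tendsto_diff assms(1) LIMSEQ_power_zero) simp
  then show "(\<lambda>s. r s - (1 / 2) ^ s) \<longlonglongrightarrow> c" by simp
  show "(\<lambda>s. max 0 (r s)) \<longlonglongrightarrow> c"
    using tendsto_max[OF tendsto_const[of 0] assms(1)] assms(2) by (simp add: max_absorb2)
  have "r s - (1 / 2) ^ s \<le> dyadic (nat \<lfloor>2 ^ s * r s\<rfloor>) s" for s
  proof -
    have "2 ^ s * r s - 1 \<le> real (nat \<lfloor>2 ^ s * r s\<rfloor>)" by linarith
    then have "(2 ^ s * r s - 1) / 2 ^ s \<le> dyadic (nat \<lfloor>2 ^ s * r s\<rfloor>) s"
      unfolding dyadic_def by (rule divide_right_mono) simp
    then show ?thesis by (simp add: diff_divide_distrib power_one_over)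
  qed
  then show "\<forall>\<^sub>F s in sequentially. r s - (1 / 2) ^ s \<le> dyadic (nat \<lfloor>2 ^ s * r s\<rfloor>) s" by simp
  have "dyadic (nat \<lfloor>2 ^ s * r s\<rfloor>) s \<le> max 0 (r s)" for s
  proof -
    have "real (nat \<lfloor>2 ^ s * r s\<rfloor>) \<le> max 0 (2 ^ s * r s)" by linarith
    also have "\<dots> = max 0 (r s) * 2 ^ s" by (simp add: max_mult_distrib_right mult.commute)
    finally show ?thesis by (simp add: dyadic_def divide_le_eq)
  qed
  then show "\<forall>\<^sub>F s in sequentially. dyadic (nat \<lfloor>2 ^ s * r s\<rfloor>) s \<le> max 0 (r s)" by simp
qed

section \<open>Lower semicomputable functions\<close>

lemma int_decode_parity:
  "int_decode n = (if even n then int ((n + 1) div 2) else - int ((n + 1) div 2))"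
  by (auto simp: int_decode_def sum_decode_def elim!: evenE oddE)

lemma of_rat_nat_to_rat_surj:
  "real_of_rat (nat_to_rat_surj v) =
     (if even (pfst v) \<longleftrightarrow> even (psnd v) then 1 else -1) *
     (real ((pfst v + 1) div 2) / real ((psnd v + 1) div 2))"
proof -
  have quotient: "real_of_int (if P then int a else - int a) /
      real_of_int (if Q then int b else - int b) = (if P \<longleftrightarrow> Q then 1 else -1) * (real a / real b)"
    for P Q a b
    by simp
  have "nat_to_rat_surj v = Fract (int_decode (pfst v)) (int_decode (psnd v))"
    by (simp add: nat_to_rat_surj_def pfst_def psnd_def split: prod.split)
  also have "real_of_rat \<dots> = real_of_int (int_decode (pfst v)) / real_of_int (int_decode (psnd v))"
    by (cases "int_decode (psnd v) = 0") (simp_all add: of_rat_rat rat_number_collapse)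
  also have "\<dots> = (if even (pfst v) \<longleftrightarrow> even (psnd v) then 1 else -1) *
     (real ((pfst v + 1) div 2) / real ((psnd v + 1) div 2))"
    unfolding int_decode_parity by (rule quotient)
  finally show ?thesis .
qed

lemma computable_dyadic_floor:
  assumes "computable A f" "computable A s"
  shows "computable A (\<lambda>x. nat \<lfloor>2 ^ s x * real_of_rat (nat_to_rat_surj (f x))\<rfloor>)"
proof -
  have "nat \<lfloor>2 ^ k * real_of_rat (nat_to_rat_surj v)\<rfloor> =
      (if even (pfst v) \<longleftrightarrow> even (psnd v) then (2 ^ k * ((pfst v + 1) div 2)) div ((psnd v + 1) div 2)
       else 0)" for k v
  proof -
    have "nat \<lfloor>2 ^ k * (real a / real b)\<rfloor> = (2 ^ k * a) div b" for a b
      using floor_divide_of_nat_eq[of "2 ^ k * a" b, where 'a = real] by simp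
    moreover have "nat \<lfloor>- (2 ^ k * (real a / real b))\<rfloor> = 0" for a b
    proof -
      have "0 \<le> 2 ^ k * (real a / real b)" by simp
      then show ?thesis by linarith
    qed
    ultimately show ?thesis unfolding of_rat_nat_to_rat_surj by simp
  qed
  then show ?thesis by (simp only:) (intro computable_intros assms)
qed

lemma lower_semicomputable_comp:
  assumes f: "lower_semicomputable A enc f"
    and r: "computable A r" "\<And>x. enc (h x) = r (enc' x)"
  shows "lower_semicomputable A enc' (\<lambda>x. f (h x))"
proof -
  obtain q p where p: "\<And>x s. \<exists>v. run A p (prod_encode (enc x, s)) = Some v \<and>
      nat_to_rat_surj v = q (x, s)"
    and q: "\<And>x. mono (\<lambda>s. q (x, s))" "\<And>x. (\<lambda>s. real_of_rat (q (x, s))) \<longlonglongrightarrow> f x"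
    using f unfolding lower_semicomputable_def computable_rat_def by fastforce
  have "computable2 A (\<lambda>c s. prod_encode (r c, s))"
    by (intro computable_intros computable_comp[OF r(1)])
  then obtain p' where "\<And>z. run A p' z = Some (prod_encode (r (pfst z), psnd z))"
    unfolding computable_def by blast
  then have "run A (Comp p p') (prod_encode (enc' x, s)) = run A p (prod_encode (enc (h x), s))"
    for x s
    by (simp add: r(2))
  then have "computable_rat A (\<lambda>(x, s). prod_encode (enc' x, s)) (\<lambda>(x, s). q (h x, s))"
    unfolding computable_rat_def using p by (intro exI[of _ "Comp p p'"]) (auto simp del: run.simps)
  then show ?thesis
    unfolding lower_semicomputable_def using q by (intro exI[of _ "\<lambda>(x, s). q (h x, s)"]) auto
qed

lemma lower_semicomputable_SUP:
  assumes comp: "computable2 A V"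
    and bdd: "\<And>z. bdd_above (range (\<lambda>k. dyadic (V z k) k))"
  shows "lower_semicomputable A (\<lambda>z. z) (\<lambda>z. SUP k. dyadic (V z k) k)"
proof -
  define q where "q = (\<lambda>(z, s). nat_to_rat_surj (prod_encode (2 * running_max (V z) s, 2 * 2 ^ s)))"
  have q: "real_of_rat (q (z, s)) = dyadic (running_max (V z) s) s" for z s
    unfolding q_def by (simp add: of_rat_nat_to_rat_surj dyadic_def)
  have "computable2 A (\<lambda>z s. prod_encode (2 * running_max (V z) s, 2 * 2 ^ s))"
    by (intro computable_intros computable_comp2[OF comp])
  then have "computable_rat A (\<lambda>(z, s). prod_encode (z, s)) q"
    unfolding computable_def computable_rat_def q_def
    by (auto split: prod.splits) (metis pfst_prod_encode psnd_prod_encode)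
  moreover have "mono (\<lambda>s. q (z, s))" for z
    using incseq_dyadic_running_max[of "V z"] unfolding mono_def q[symmetric] of_rat_less_eq by blast
  moreover have "(\<lambda>s. real_of_rat (q (z, s))) \<longlonglongrightarrow> (SUP k. dyadic (V z k) k)" for z
    unfolding q by (rule tendsto_dyadic_running_max[OF bdd])
  ultimately show ?thesis unfolding lower_semicomputable_def by blast
qed

lemma lower_semicomputable_dyadicE:
  assumes f: "lower_semicomputable A (\<lambda>z. z) f" and nonneg: "\<And>z. 0 \<le> f z"
  obtains u where "computable2 A u"
    and "\<And>z. incseq (\<lambda>s. dyadic (u z s) s)" "\<And>z. (\<lambda>s. dyadic (u z s) s) \<longlonglongrightarrow> f z"
proof -
  obtain q p where p: "\<And>z s. \<exists>v. run A p (prod_encode (z, s)) = Some v \<and>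
      nat_to_rat_surj v = q (z, s)"
    and mono: "\<And>z. mono (\<lambda>s. q (z, s))" and lim: "\<And>z. (\<lambda>s. real_of_rat (q (z, s))) \<longlonglongrightarrow> f z"
    using f unfolding lower_semicomputable_def computable_rat_def by fastforce
  define v where "v c = the (run A p c)" for c
  have "run A p c = Some (v c)" for c
    unfolding v_def using p[of "pfst c" "psnd c"] by auto
  then have "computable A v" unfolding computable_def by blast
  have v: "nat_to_rat_surj (v (prod_encode (z, s))) = q (z, s)" for z s
    unfolding v_def using p[of z s] by auto
  define u where "u z s = nat \<lfloor>2 ^ s * real_of_rat (q (z, s))\<rfloor>" for z s
  show thesis
  proof (rule that)
    show "computable2 A u"
      unfolding u_def v[symmetric]
      by (intro computable_dyadic_floor computable_comp[OF \<open>computable A v\<close>] computable_intros)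
    have "incseq (\<lambda>s. real_of_rat (q (z, s)))" for z
      using mono[of z] by (simp add: mono_def of_rat_less_eq)
    then show "incseq (\<lambda>s. dyadic (u z s) s)" for z unfolding u_def by (rule incseq_dyadic_floor)
    show "(\<lambda>s. dyadic (u z s) s) \<longlonglongrightarrow> f z" for z
      unfolding u_def by (intro tendsto_dyadic_floor lim nonneg)
  qed
qed

lemma lower_semicomputable_string_iff:
  "lower_semicomputable A string_encode f \<longleftrightarrow> lower_semicomputable A (\<lambda>z. z) (\<lambda>i. f (string_of i))"
proof
  assume "lower_semicomputable A string_encode f"
  then show "lower_semicomputable A (\<lambda>z. z) (\<lambda>i. f (string_of i))"
    by (rule lower_semicomputable_comp[OF _ computable_string_encode_string_of]) (rule refl)
next
  obtain r where "computable A r" "\<And>x. r (string_encode x) = node x"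
    using computable_node_of_code by blast
  moreover assume "lower_semicomputable A (\<lambda>z. z) (\<lambda>i. f (string_of i))"
  ultimately show "lower_semicomputable A string_encode f"
    using lower_semicomputable_comp[of A "\<lambda>z. z" "\<lambda>i. f (string_of i)" r node string_encode] by simp
qed

lemma lower_semicomputable_cond_string_iff:
  "lower_semicomputable A (\<lambda>(x, n). prod_encode (string_encode x, n)) (\<lambda>(x, n). f x n) \<longleftrightarrow>
   lower_semicomputable A (\<lambda>z. z) (\<lambda>z. f (string_of (pfst z)) (psnd z))"
proof
  have "computable2 A (\<lambda>i n. prod_encode (string_encode (string_of i), n))"
    by (intro computable_intros computable_comp[OF computable_string_encode_string_of])
  moreover assume
    "lower_semicomputable A (\<lambda>(x, n). prod_encode (string_encode x, n)) (\<lambda>(x, n). f x n)"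
  ultimately show "lower_semicomputable A (\<lambda>z. z) (\<lambda>z. f (string_of (pfst z)) (psnd z))"
    using lower_semicomputable_comp[where h = "\<lambda>z. (string_of (pfst z), psnd z)" and enc' = "\<lambda>z. z"]
    by fastforce
next
  obtain r where r: "computable A r" "\<And>x. r (string_encode x) = node x"
    using computable_node_of_code by blast
  have "computable2 A (\<lambda>c n. prod_encode (r c, n))"
    by (intro computable_intros computable_comp[OF r(1)])
  moreover assume "lower_semicomputable A (\<lambda>z. z) (\<lambda>z. f (string_of (pfst z)) (psnd z))"
  ultimately show
    "lower_semicomputable A (\<lambda>(x, n). prod_encode (string_encode x, n)) (\<lambda>(x, n). f x n)"
    using lower_semicomputable_comp[where h = "\<lambda>(x, n). prod_encode (node x, n)"
        and enc' = "\<lambda>(x, n). prod_encode (string_encode x, n)"]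
    by (fastforce simp: r(2) split_def)
qed

section \<open>Lower semicomputable semimeasures\<close>

lemma lsc_semimeasure_dyadicE:
  assumes "lsc_semimeasure A m"
  obtains u where "\<And>x. incseq (\<lambda>s. dyadic (u x s) s)" "\<And>x. (\<lambda>s. dyadic (u x s) s) \<longlonglongrightarrow> m x"
    and "computable2 A (\<lambda>i s. u (string_of i) s)"
proof -
  have "lower_semicomputable A (\<lambda>z. z) (\<lambda>i. m (string_of i))" "\<And>x. 0 \<le> m x"
    using assms unfolding lsc_semimeasure_def semimeasure_def lower_semicomputable_string_iff by auto
  then obtain u where u: "computable2 A u" "\<And>i. incseq (\<lambda>s. dyadic (u i s) s)"
    "\<And>i. (\<lambda>s. dyadic (u i s) s) \<longlonglongrightarrow> m (string_of i)"
    by (rule lower_semicomputable_dyadicE) blast+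
  show thesis
    by (rule that[of "\<lambda>x. u (node x)"]) (use u(1,2) u(3)[of "node _"] in simp_all)
qed

lemma cond_lsc_semimeasure_dyadicE:
  assumes "cond_lsc_semimeasure A a"
  obtains u where "\<And>x n. incseq (\<lambda>s. dyadic (u x n s) s)" "\<And>x n. (\<lambda>s. dyadic (u x n s) s) \<longlonglongrightarrow> a x n"
    and "computable3 A (\<lambda>i n s. u (string_of i) n s)"
proof -
  have "lower_semicomputable A (\<lambda>z. z) (\<lambda>z. a (string_of (pfst z)) (psnd z))" "\<And>x n. 0 \<le> a x n"
    using assms
    unfolding cond_lsc_semimeasure_def semimeasure_def lower_semicomputable_cond_string_iff by auto
  then obtain u where u: "computable2 A u" "\<And>z. incseq (\<lambda>s. dyadic (u z s) s)"
    "\<And>z. (\<lambda>s. dyadic (u z s) s) \<longlonglongrightarrow> a (string_of (pfst z)) (psnd z)"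
    by (rule lower_semicomputable_dyadicE) blast+
  show thesis
  proof (rule that[of "\<lambda>x n. u (prod_encode (node x, n))"])
    show "computable3 A (\<lambda>i n s. u (prod_encode (node (string_of i), n)) s)"
      unfolding node_string_of by (intro computable_comp2[OF u(1)] computable_intros)
  qed (use u(2) u(3)[of "prod_encode (node _, _)"] in simp_all)
qed

lemma lsc_semimeasure_of_cond:
  assumes "cond_lsc_semimeasure A b"
  shows "lsc_semimeasure A (\<lambda>x. b x n)"
proof -
  have "computable A (\<lambda>c. prod_encode (c, n))" by (intro computable_intros)
  then have "lower_semicomputable A string_encode (\<lambda>x. b x n)"
    using assms unfolding cond_lsc_semimeasure_def
    by (fastforce dest: lower_semicomputable_comp[where h = "\<lambda>x. (x, n)" and enc' = string_encode])
  then show ?thesis using assms unfolding lsc_semimeasure_def cond_lsc_semimeasure_def by blast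
qed

locale kraft_weights =
  fixes H :: "bool list \<Rightarrow> nat \<Rightarrow> nat"
  assumes incseq_weight: "incseq (\<lambda>k. dyadic (H y k) k)"
    and kraft_inequality_weight: "kraft_inequality (\<lambda>y. dyadic (H y k) k)"
begin

definition limit_weight :: "bool list \<Rightarrow> real" where
  "limit_weight y = (SUP k. dyadic (H y k) k)"

definition hull_numerator :: "bool list \<Rightarrow> nat \<Rightarrow> nat" where
  "hull_numerator x c = (if string_set (pfst c) \<in> prefix_free_above x
     then (\<Sum>y\<in>string_set (pfst c). H y (psnd c)) * 2 ^ (c - psnd c) else 0)"

lemma bdd_above_weight: "bdd_above (range (\<lambda>k. dyadic (H y k) k))"
proof (rule bdd_aboveI2)
  show "dyadic (H y k) k \<le> 1" for k
    using kraft_inequality_sum_le_1[OF kraft_inequality_weight singleton_prefix_free_above] by simp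
qed

lemma tendsto_limit_weight: "(\<lambda>k. dyadic (H y k) k) \<longlonglongrightarrow> limit_weight y"
  unfolding limit_weight_def using bdd_above_weight incseq_weight by (rule LIMSEQ_incseq_SUP)

lemma weight_le_limit_weight: "dyadic (H y k) k \<le> limit_weight y"
  unfolding limit_weight_def using bdd_above_weight by (rule cSUP_upper[OF UNIV_I])

lemma tendsto_sum_limit_weight: "(\<lambda>k. \<Sum>y\<in>W. dyadic (H y k) k) \<longlonglongrightarrow> sum limit_weight W"
  by (intro tendsto_sum tendsto_limit_weight)

lemma kraft_inequality_limit_weight: "kraft_inequality limit_weight"
  unfolding kraft_inequality_def
proof
  fix W assume "W \<in> prefix_free_above ([] :: bool list)"
  then show "sum limit_weight W \<le> 1"
    using kraft_inequality_sum_le_1[OF kraft_inequality_weight]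
    by (intro LIMSEQ_le_const2[OF tendsto_sum_limit_weight]) blast
qed

lemma dyadic_hull_numerator:
  "dyadic (hull_numerator x c) c = (if string_set (pfst c) \<in> prefix_free_above x
     then \<Sum>y\<in>string_set (pfst c). dyadic (H y (psnd c)) (psnd c) else 0)"
  by (simp add: hull_numerator_def dyadic_rescale[OF psnd_le] dyadic_sum)

lemma dyadic_hull_numerator_le: "dyadic (hull_numerator x c) c \<le> semimeasure_hull limit_weight x"
proof (cases "string_set (pfst c) \<in> prefix_free_above x")
  case True
  then have "dyadic (hull_numerator x c) c \<le> sum limit_weight (string_set (pfst c))"
    by (simp add: dyadic_hull_numerator sum_mono weight_le_limit_weight)
  also have "\<dots> \<le> semimeasure_hull limit_weight x"
    using kraft_inequality_limit_weight True by (rule sum_le_semimeasure_hull)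
  finally show ?thesis .
next
  case False
  then show ?thesis
    using sum_le_semimeasure_hull[OF kraft_inequality_limit_weight empty_prefix_free_above]
    by (simp add: dyadic_hull_numerator)
qed

lemma bdd_above_hull_numerator: "bdd_above (range (\<lambda>c. dyadic (hull_numerator x c) c))"
  using dyadic_hull_numerator_le by (rule bdd_aboveI2)

lemma semimeasure_hull_limit_weight:
  "semimeasure_hull limit_weight x = (SUP c. dyadic (hull_numerator x c) c)"
proof (rule antisym)
  show "(SUP c. dyadic (hull_numerator x c) c) \<le> semimeasure_hull limit_weight x"
    using dyadic_hull_numerator_le by (intro cSUP_least) auto
  have "sum limit_weight W \<le> (SUP c. dyadic (hull_numerator x c) c)"
    if W: "W \<in> prefix_free_above x" for W
  proof (rule LIMSEQ_le_const2[OF tendsto_sum_limit_weight], intro exI allI impI)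
    fix k
    define c where "c = prod_encode (set_encode (node ` W), k)"
    have "string_set (pfst c) = W" "psnd c = k"
      using W by (simp_all add: c_def string_set_set_encode prefix_free_above_def)
    then have "(\<Sum>y\<in>W. dyadic (H y k) k) = dyadic (hull_numerator x c) c"
      using W by (simp add: dyadic_hull_numerator)
    also have "\<dots> \<le> (SUP c. dyadic (hull_numerator x c) c)"
      using bdd_above_hull_numerator by (rule cSUP_upper[OF UNIV_I])
    finally show "(\<Sum>y\<in>W. dyadic (H y k) k) \<le> (SUP c. dyadic (hull_numerator x c) c)" .
  qed
  then show "semimeasure_hull limit_weight x \<le> (SUP c. dyadic (hull_numerator x c) c)"
    unfolding semimeasure_hull_def using empty_prefix_free_above by (intro cSUP_least) blast+
qed

end

lemma cond_lsc_semimeasure_of_weights: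
  assumes comp: "computable3 A (\<lambda>i n k. H (string_of i) n k)"
    and weights: "\<And>n. kraft_weights (\<lambda>y. H y n)"
  obtains b where "cond_lsc_semimeasure A b" "\<And>x n k. dyadic (H x n k) k \<le> b x n"
proof
  define g where "g n = kraft_weights.limit_weight (\<lambda>y. H y n)" for n
  define V where "V z = kraft_weights.hull_numerator (\<lambda>y. H y (psnd z)) (string_of (pfst z))"
    for z
  have kraft: "kraft_inequality (g n)" for n
    unfolding g_def by (rule kraft_weights.kraft_inequality_limit_weight[OF weights])
  have "computable2 A V"
    unfolding V_def kraft_weights.hull_numerator_def[OF weights]
    by (intro computable_intros computable_sum_string_set computable_comp3[OF comp])
  then have "lower_semicomputable A (\<lambda>z. z) (\<lambda>z. SUP c. dyadic (V z c) c)"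
    unfolding V_def
    by (rule lower_semicomputable_SUP) (rule kraft_weights.bdd_above_hull_numerator[OF weights])
  also have "(\<lambda>z. SUP c. dyadic (V z c) c) =
      (\<lambda>z. semimeasure_hull (g (psnd z)) (string_of (pfst z)))"
    unfolding V_def g_def kraft_weights.semimeasure_hull_limit_weight[OF weights] ..
  finally show "cond_lsc_semimeasure A (\<lambda>x n. semimeasure_hull (g n) x)"
    unfolding cond_lsc_semimeasure_def lower_semicomputable_cond_string_iff
    using semimeasure_semimeasure_hull[OF kraft] by simp
  show "dyadic (H x n k) k \<le> semimeasure_hull (g n) x" for x n k
  proof -
    have "dyadic (H x n k) k \<le> g n x"
      unfolding g_def by (rule kraft_weights.weight_le_limit_weight[OF weights])
    also have "\<dots> \<le> semimeasure_hull (g n) x" using kraft by (rule semimeasure_hull_ge)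
    finally show ?thesis .
  qed
qed

lemma maximal_lsc_semimeasure_pos:
  assumes "maximal_lsc_semimeasure A m"
  shows "0 < m x"
proof -
  define H where "H y (n::nat) k = (if y = x then 2 ^ k else 0 :: nat)" for y n k
  have dyadic_H: "dyadic (H y n k) k = (if y = x then 1 else 0)" for y n k
    by (simp add: H_def dyadic_def)
  have "kraft_weights (\<lambda>y. H y n)" for n
  proof
    show "incseq (\<lambda>k. dyadic (H y n k) k)" for y by (simp add: dyadic_H incseq_def)
    show "kraft_inequality (\<lambda>y. dyadic (H y n k) k)" for k
      by (simp add: dyadic_H kraft_inequality_def prefix_free_above_def)
  qed
  moreover have "string_of i = x \<longleftrightarrow> i = node x" for i by auto
  then have "computable3 A (\<lambda>i n k. H (string_of i) n k)"
    unfolding H_def by (simp only:) (intro computable_intros)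
  ultimately obtain b where b: "cond_lsc_semimeasure A b" "\<And>x n k. dyadic (H x n k) k \<le> b x n"
    using cond_lsc_semimeasure_of_weights by blast
  obtain C where "0 < C" "b x 0 \<le> C * m x"
    using assms lsc_semimeasure_of_cond[OF b(1), of 0]
    unfolding maximal_lsc_semimeasure_def by blast
  moreover have "1 \<le> b x 0" using b(2)[of x 0 0] by (simp add: dyadic_H)
  ultimately show ?thesis by (smt (verit) zero_less_mult_pos)
qed

section \<open>Trimming to a semimeasure\<close>

definition admissible :: "(bool list \<Rightarrow> nat \<Rightarrow> nat) \<Rightarrow> nat \<Rightarrow> bool" where
  "admissible M s \<longleftrightarrow> kraft_inequality (\<lambda>y. if node y < s then dyadic (M y s) s else 0)"

definition last_admissible :: "(bool list \<Rightarrow> nat \<Rightarrow> nat) \<Rightarrow> nat \<Rightarrow> nat" where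
  "last_admissible M k = max_below (\<lambda>s. if admissible M s then s else 0) (Suc k)"

definition trimmed :: "(bool list \<Rightarrow> nat \<Rightarrow> nat) \<Rightarrow> bool list \<Rightarrow> nat \<Rightarrow> nat" where
  "trimmed M y k = (if node y < last_admissible M k
     then M y (last_admissible M k) * 2 ^ (k - last_admissible M k) else 0)"

lemma admissible_iff_string_set:
  "admissible M s \<longleftrightarrow> (\<forall>w<2 ^ s. string_set w \<in> prefix_free_above [] \<longrightarrow>
     (\<Sum>y\<in>string_set w. M y s) \<le> 2 ^ s)"
proof -
  have "(\<Sum>y\<in>string_set w. if node y < s then dyadic (M y s) s else 0) =
      dyadic (\<Sum>y\<in>string_set (set_encode (set_decode w \<inter> {..<s})). M y s) s" for w
    by (simp add: sum_string_set dyadic_sum sum.inter_restrict if_distrib[of "\<lambda>v. dyadic v s"]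
        cong: if_cong)
  then have "admissible M s \<longleftrightarrow> (\<forall>w. string_set w \<in> prefix_free_above [] \<longrightarrow>
      (\<Sum>y\<in>string_set (set_encode (set_decode w \<inter> {..<s})). M y s) \<le> 2 ^ s)"
    unfolding admissible_def kraft_inequality_def ball_prefix_free_above_iff
    by (simp add: dyadic_le_1_iff)
  also have "\<dots> \<longleftrightarrow> (\<forall>w<2 ^ s. string_set w \<in> prefix_free_above [] \<longrightarrow>
      (\<Sum>y\<in>string_set w. M y s) \<le> 2 ^ s)"
  proof (intro iffI allI impI)
    fix w
    assume "\<forall>w. string_set w \<in> prefix_free_above [] \<longrightarrow>
        (\<Sum>y\<in>string_set (set_encode (set_decode w \<inter> {..<s})). M y s) \<le> 2 ^ s"
      and "w < 2 ^ s" "string_set w \<in> prefix_free_above []"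
    then show "(\<Sum>y\<in>string_set w. M y s) \<le> 2 ^ s"
      by (metis inf.absorb1 set_decode_inverse set_decode_subset_lessThan_iff)
  next
    fix w
    let ?v = "set_encode (set_decode w \<inter> {..<s})"
    assume sum_le: "\<forall>w<2 ^ s. string_set w \<in> prefix_free_above [] \<longrightarrow>
        (\<Sum>y\<in>string_set w. M y s) \<le> 2 ^ s"
      and w: "string_set w \<in> prefix_free_above []"
    have "?v < 2 ^ s" by (simp flip: set_decode_subset_lessThan_iff)
    moreover have "string_set ?v \<in> prefix_free_above []"
      by (rule prefix_free_above_subset[OF w]) (auto simp: string_set_def)
    ultimately show "(\<Sum>y\<in>string_set ?v. M y s) \<le> 2 ^ s" using sum_le by blast
  qed
  finally show ?thesis .
qed

lemma admissible_last_admissible: "admissible M (last_admissible M k)"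
proof -
  have "admissible M 0" by (simp add: admissible_def kraft_inequality_def)
  then show ?thesis
    using max_below_attained[OF zero_less_Suc, of k "\<lambda>s. if admissible M s then s else 0"]
    unfolding last_admissible_def by auto
qed

lemma last_admissible_le: "last_admissible M k \<le> k"
  unfolding last_admissible_def max_below_le_iff by auto

lemma last_admissible_ge: "admissible M s \<Longrightarrow> s \<le> k \<Longrightarrow> s \<le> last_admissible M k"
  using max_below_ge[of s "Suc k" "\<lambda>s. if admissible M s then s else 0"]
  unfolding last_admissible_def by simp

lemma last_admissible_mono: "k \<le> l \<Longrightarrow> last_admissible M k \<le> last_admissible M l"
  by (meson admissible_last_admissible last_admissible_ge last_admissible_le order_trans)

lemma trimmed_eq: "admissible M s \<Longrightarrow> node y < s \<Longrightarrow> trimmed M y s = M y s"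
  using last_admissible_ge[of M s s] last_admissible_le[of M s] by (simp add: trimmed_def)

lemma dyadic_trimmed:
  "dyadic (trimmed M y k) k = (if node y < last_admissible M k
     then dyadic (M y (last_admissible M k)) (last_admissible M k) else 0)"
  by (simp add: trimmed_def dyadic_rescale last_admissible_le)

lemma kraft_weights_trimmed:
  assumes incseq: "\<And>y. incseq (\<lambda>s. dyadic (M y s) s)"
  shows "kraft_weights (trimmed M)"
proof
  show "incseq (\<lambda>k. dyadic (trimmed M y k) k)" for y
  proof (rule incseq_SucI)
    fix k
    have "last_admissible M k \<le> last_admissible M (Suc k)" by (rule last_admissible_mono) simp
    then show "dyadic (trimmed M y k) k \<le> dyadic (trimmed M y (Suc k)) (Suc k)"
      using incseqD[OF incseq] by (simp add: dyadic_trimmed)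
  qed
  show "kraft_inequality (\<lambda>y. dyadic (trimmed M y k) k)" for k
    using admissible_last_admissible unfolding admissible_def dyadic_trimmed .
qed

lemma computable_trimmed:
  assumes "computable3 A (\<lambda>i n s. M (string_of i) n s)"
  shows "computable3 A (\<lambda>i n k. trimmed (\<lambda>y. M y n) (string_of i) k)"
proof -
  have admissible: "decidable2 A (\<lambda>n s. admissible (\<lambda>y. M y n) s)"
    unfolding admissible_iff_string_set
    by (intro computable_intros computable_sum_string_set computable_comp3[OF assms])
  have last: "computable2 A (\<lambda>n k. last_admissible (\<lambda>y. M y n) k)"
    unfolding last_admissible_def by (intro computable_intros decidable_comp2[OF admissible])
  show ?thesis
    unfolding trimmed_def node_string_of
    by (intro computable_intros computable_comp3[OF assms] computable_comp2[OF last])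
qed

lemma admissible_if_le_semimeasure:
  assumes "semimeasure m" and le_m: "\<And>y. node y < s \<Longrightarrow> dyadic (M y s) s \<le> m y"
  shows "admissible M s"
  unfolding admissible_def
proof (rule kraft_inequality_mono)
  show "kraft_inequality m" using assms(1) by (rule kraft_inequality_semimeasure)
  show "(if node y < s then dyadic (M y s) s else 0) \<le> m y" for y
    using le_m assms(1) by (simp add: semimeasure_def)
qed

lemma eventually_running_max_eq:
  assumes lim: "\<And>y t. \<forall>\<^sub>F n in sequentially. v y t n = u y t"
    and incseq: "\<And>y. incseq (\<lambda>s. dyadic (u y s) s)"
  shows "\<forall>\<^sub>F n in sequentially. \<forall>y. node y < s \<longrightarrow> running_max (\<lambda>t. v y t n) s = u y s"
proof -
  have "\<forall>\<^sub>F n in sequentially. \<forall>p\<in>{..<s} \<times> {..s}.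
      v (string_of (fst p)) (snd p) n = u (string_of (fst p)) (snd p)"
    using lim by (intro eventually_ball_finite) auto
  then show ?thesis
  proof eventually_elim
    case (elim n)
    have "running_max (\<lambda>t. v y t n) s = running_max (u y) s" if "node y < s" for y
    proof (rule running_max_cong)
      fix t assume "t \<le> s"
      then show "v y t n = u y t" using bspec[OF elim, of "(node y, t)"] that by simp
    qed
    then show ?case using running_max_incseq[OF incseq] by simp
  qed
qed

lemma eventually_dyadic_trimmed_eq:
  assumes m: "semimeasure m"
    and incseq: "\<And>y. incseq (\<lambda>s. dyadic (u y s) s)"
    and lim_u: "\<And>y. (\<lambda>s. dyadic (u y s) s) \<longlonglongrightarrow> m y"
    and lim_v: "\<And>y t. \<forall>\<^sub>F n in sequentially. v y t n = u y t"
    and x: "node x < s"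
  shows "\<forall>\<^sub>F n in sequentially.
    dyadic (trimmed (\<lambda>y. running_max (\<lambda>t. v y t n)) x s) s = dyadic (u x s) s"
proof -
  have "\<forall>\<^sub>F n in sequentially. \<forall>y. node y < s \<longrightarrow> running_max (\<lambda>t. v y t n) s = u y s"
    using lim_v incseq by (rule eventually_running_max_eq)
  then show ?thesis
  proof eventually_elim
    case (elim n)
    have "dyadic (u y s) s \<le> m y" for y using incseq lim_u by (rule incseq_le)
    then have "admissible (\<lambda>y. running_max (\<lambda>t. v y t n)) s"
      using m elim by (intro admissible_if_le_semimeasure) auto
    then show ?case using elim x by (simp add: trimmed_eq)
  qed
qed

lemma halting_semimeasure_le_liminf:
  assumes m: "lsc_semimeasure halting_problem m"
  obtains b where "cond_lsc_semimeasure {} b"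
    and "\<And>x r. r < m x \<Longrightarrow> \<forall>\<^sub>F n in sequentially. r \<le> b x n"
proof -
  obtain u where incseq_u: "\<And>y. incseq (\<lambda>s. dyadic (u y s) s)"
    and lim_u: "\<And>y. (\<lambda>s. dyadic (u y s) s) \<longlonglongrightarrow> m y"
    and comp_u: "computable2 halting_problem (\<lambda>i s. u (string_of i) s)"
    using m by (rule lsc_semimeasure_dyadicE) (erule that)
  obtain g where comp_g: "computable2 {} g"
    and lim_g: "\<And>z. \<forall>\<^sub>F n in sequentially. g z n = u (string_of (pfst z)) (psnd z)"
    using limit_lemma[OF comp_u] by blast
  define v where "v y t n = g (prod_encode (node y, t)) n" for y t n
  have lim_v: "\<forall>\<^sub>F n in sequentially. v y t n = u y t" for y t
    using lim_g[of "prod_encode (node y, t)"] by (simp add: v_def)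
  define M where "M y n = running_max (\<lambda>t. v y t n)" for y n
  have comp_M: "computable3 {} (\<lambda>i n s. M (string_of i) n s)"
    unfolding M_def v_def node_string_of by (intro computable_intros computable_comp2[OF comp_g])
  have "kraft_weights (trimmed (\<lambda>y. M y n))" for n
    unfolding M_def by (intro kraft_weights_trimmed incseq_dyadic_running_max)
  then obtain b where b: "cond_lsc_semimeasure {} b"
    and b_ge: "\<And>x n k. dyadic (trimmed (\<lambda>y. M y n) x k) k \<le> b x n"
    using cond_lsc_semimeasure_of_weights[OF computable_trimmed[OF comp_M]] by blast
  have "\<forall>\<^sub>F n in sequentially. r \<le> b x n" if "r < m x" for x r
  proof -
    have "\<forall>\<^sub>F s in sequentially. node x < s \<and> r < dyadic (u x s) s"
      by (intro eventually_conj eventually_gt_at_top order_tendstoD(1)[OF lim_u] \<open>r < m x\<close>)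
    then obtain s where s: "node x < s" "r < dyadic (u x s) s"
      using eventually_happens by force
    have "semimeasure m" using m unfolding lsc_semimeasure_def by blast
    from eventually_dyadic_trimmed_eq[OF this incseq_u lim_u lim_v s(1)] show ?thesis
    proof eventually_elim
      case (elim n)
      then show ?case using s(2) b_ge[of n x s] by (simp add: M_def)
    qed
  qed
  then show thesis using b that by blast
qed

section \<open>Greedy granting of requests\<close>

text \<open>Every pair of a string and an exponent is requested by infinitely many \<open>k\<close>, because \<^term>\<open>psnd k\<close>
  is ignored.\<close>

definition requested_string :: "nat \<Rightarrow> bool list" where
  "requested_string k = string_of (pfst (pfst k))"

definition requested_exponent :: "nat \<Rightarrow> nat" where
  "requested_exponent k = psnd (pfst k)"

definition requested_weight :: "nat set \<Rightarrow> bool list \<Rightarrow> real" where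
  "requested_weight K y =
     Max (insert 0 ((\<lambda>k. (1 / 2) ^ requested_exponent k) ` {k \<in> K. requested_string k = y}))"

definition requested_numerator :: "nat set \<Rightarrow> bool list \<Rightarrow> nat \<Rightarrow> nat" where
  "requested_numerator K y = running_max
     (\<lambda>k. if k \<in> K \<and> requested_string k = y then 2 ^ (k - requested_exponent k) else 0)"

lemma requested_exponent_le: "requested_exponent k \<le> k"
  unfolding requested_exponent_def using pfst_le psnd_le le_trans by meson

lemma requested_weight_le_iff:
  assumes "finite K"
  shows "requested_weight K y \<le> c \<longleftrightarrow>
    0 \<le> c \<and> (\<forall>k\<in>K. requested_string k = y \<longrightarrow> (1 / 2) ^ requested_exponent k \<le> c)"
  unfolding requested_weight_def using assms by (subst Max_le_iff) auto

lemma requested_weight_ge: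
  "finite K \<Longrightarrow> k \<in> K \<Longrightarrow> requested_string k = y \<Longrightarrow>
    (1 / 2) ^ requested_exponent k \<le> requested_weight K y"
  using requested_weight_le_iff[of K y "requested_weight K y"] by simp

lemma requested_weight_empty [simp]: "requested_weight {} y = 0"
  by (simp add: requested_weight_def)

lemma requested_weight_insert_le:
  assumes "finite K" "requested_weight K y \<le> c"
    and "requested_string k = y \<Longrightarrow> (1 / 2) ^ requested_exponent k \<le> c"
  shows "requested_weight (insert k K) y \<le> c"
  using assms by (auto simp: requested_weight_le_iff)

lemma requested_weight_mono:
  "K \<subseteq> L \<Longrightarrow> finite L \<Longrightarrow> requested_weight K y \<le> requested_weight L y"
  unfolding requested_weight_def by (intro Max_mono) auto

lemma dyadic_requested_numerator:
  assumes "K \<subseteq> {..t}"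
  shows "dyadic (requested_numerator K y t) t = requested_weight K y"
proof -
  define v :: "nat \<Rightarrow> real" where
    "v k = (if k \<in> K \<and> requested_string k = y then (1 / 2) ^ requested_exponent k else 0)" for k
  have "dyadic (requested_numerator K y t) t \<le> c \<longleftrightarrow> (\<forall>k\<le>t. v k \<le> c)" for c
    unfolding requested_numerator_def dyadic_running_max_le_iff v_def
    by (intro all_cong) (simp add: dyadic_power requested_exponent_le)
  moreover have "(\<forall>k\<le>t. v k \<le> c) \<longleftrightarrow> requested_weight K y \<le> c" for c
  proof
    assume v_le: "\<forall>k\<le>t. v k \<le> c"
    moreover have "0 \<le> v 0" by (simp add: v_def)
    ultimately have "0 \<le> c" by (meson le0 order_trans)
    moreover have "(1 / 2) ^ requested_exponent k \<le> c" if "k \<in> K" "requested_string k = y" for k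
    proof -
      have "v k \<le> c" using v_le that(1) assms by auto
      then show ?thesis using that by (simp add: v_def)
    qed
    ultimately show "requested_weight K y \<le> c"
      using finite_subset[OF assms] by (simp add: requested_weight_le_iff)
  qed (use finite_subset[OF assms] in \<open>simp add: v_def requested_weight_le_iff\<close>)
  ultimately have "dyadic (requested_numerator K y t) t \<le> c \<longleftrightarrow> requested_weight K y \<le> c" for c
    by simp
  then show ?thesis by (meson order_antisym order_refl)
qed

lemma computable_requested_numerator:
  "computable3 A (\<lambda>e i. requested_numerator (set_decode e) (string_of i))"
proof -
  have "requested_string k = string_of i \<longleftrightarrow> pfst (pfst k) = i" for k i
    unfolding requested_string_def by (rule inj_eq[OF inj_string_of])
  then show ?thesis
    unfolding requested_numerator_def requested_exponent_def
    by (simp only:) (intro computable_intros)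
qed

definition fits :: "(bool list \<Rightarrow> nat \<Rightarrow> real) \<Rightarrow> nat \<Rightarrow> nat set \<Rightarrow> bool" where
  "fits a s K \<longleftrightarrow> (\<forall>n\<ge>s. kraft_inequality (\<lambda>y. max (a y n) (requested_weight K y)))"

lemma sum_max_requested_weight_le_1_iff:
  assumes incseq: "\<And>y. incseq (\<lambda>t. dyadic (u y t) t)"
    and lim: "\<And>y. (\<lambda>t. dyadic (u y t) t) \<longlonglongrightarrow> f y" and K: "K \<subseteq> {..e}"
  shows "(\<Sum>y\<in>W. max (f y) (requested_weight K y)) \<le> 1 \<longleftrightarrow>
    (\<forall>t\<ge>e. (\<Sum>y\<in>W. max (u y t) (requested_numerator K y t)) \<le> 2 ^ t)"
proof -
  let ?S = "\<lambda>t. \<Sum>y\<in>W. max (dyadic (u y t) t) (requested_weight K y)"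
  have "(\<Sum>y\<in>W. max (u y t) (requested_numerator K y t)) \<le> 2 ^ t \<longleftrightarrow> ?S t \<le> 1" if "e \<le> t" for t
  proof -
    have "K \<subseteq> {..t}" using K that by auto
    then show ?thesis
      by (simp add: dyadic_sum dyadic_max dyadic_requested_numerator flip: dyadic_le_1_iff)
  qed
  moreover have "(\<Sum>y\<in>W. max (f y) (requested_weight K y)) \<le> 1 \<longleftrightarrow> (\<forall>t\<ge>e. ?S t \<le> 1)"
  proof
    have "?S t \<le> (\<Sum>y\<in>W. max (f y) (requested_weight K y))" for t
      by (intro sum_mono max.mono incseq_le[OF incseq lim] order_refl)
    then show "\<forall>t\<ge>e. ?S t \<le> 1" if "(\<Sum>y\<in>W. max (f y) (requested_weight K y)) \<le> 1"
      using that order_trans by blast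
    have "?S \<longlonglongrightarrow> (\<Sum>y\<in>W. max (f y) (requested_weight K y))"
      by (intro tendsto_sum tendsto_max lim tendsto_const)
    then show "(\<Sum>y\<in>W. max (f y) (requested_weight K y)) \<le> 1" if "\<forall>t\<ge>e. ?S t \<le> 1"
      using that by (meson LIMSEQ_le_const2)
  qed
  ultimately show ?thesis by simp
qed

lemma decidable_fits:
  assumes "cond_lsc_semimeasure {} a"
  shows "decidable2 halting_problem (\<lambda>s e. fits a s (set_decode e))"
proof -
  obtain u where incseq: "\<And>y n. incseq (\<lambda>t. dyadic (u y n t) t)"
    and lim: "\<And>y n. (\<lambda>t. dyadic (u y n t) t) \<longlonglongrightarrow> a y n"
    and comp_u: "computable3 {} (\<lambda>i n t. u (string_of i) n t)"
    using assms by (rule cond_lsc_semimeasure_dyadicE) (erule that)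
  define overflow where "overflow e w n t \<longleftrightarrow> string_set w \<in> prefix_free_above [] \<and>
      2 ^ t < (\<Sum>y\<in>string_set w. max (u y n t) (requested_numerator (set_decode e) y t))"
    for e w n t
  have fits_iff: "fits a s (set_decode e) \<longleftrightarrow>
      \<not> (\<exists>m. overflow e (pfst m) (s + pfst (psnd m)) (e + psnd (psnd m)))" for s e
  proof -
    have "set_decode e \<subseteq> {..e}" using set_decode_less by (auto intro: less_imp_le)
    then have "fits a s (set_decode e) \<longleftrightarrow> \<not> (\<exists>w. \<exists>n\<ge>s. \<exists>t\<ge>e. overflow e w n t)"
      unfolding fits_def kraft_inequality_def overflow_def ball_prefix_free_above_iff
        sum_max_requested_weight_le_1_iff[OF incseq lim \<open>set_decode e \<subseteq> {..e}\<close>]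
      by (auto simp: not_less)
    also have "(\<exists>w. \<exists>n\<ge>s. \<exists>t\<ge>e. overflow e w n t) \<longleftrightarrow>
        (\<exists>m. overflow e (pfst m) (s + pfst (psnd m)) (e + psnd (psnd m)))"
      by (metis le_add1 le_iff_add pfst_prod_encode psnd_prod_encode)
    finally show ?thesis .
  qed
  have "decidable2 {} (\<lambda>z m. overflow (psnd z) (pfst m) (pfst z + pfst (psnd m))
      (psnd z + psnd (psnd m)))"
    unfolding overflow_def
    by (intro computable_intros computable_sum_string_set computable_comp3[OF comp_u]
        computable_comp3[OF computable_requested_numerator])
  then show ?thesis unfolding fits_iff by (intro decidable_not decidable_halting_problem_ex)
qed

primrec granted :: "(bool list \<Rightarrow> nat \<Rightarrow> real) \<Rightarrow> nat \<Rightarrow> nat set" where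
  "granted a 0 = {}"
| "granted a (Suc s) =
     (if fits a s (insert s (granted a s)) then insert s (granted a s) else granted a s)"

lemma granted_subset: "granted a s \<subseteq> {..<s}"
  by (induction s) auto

lemma granted_subset_atMost: "granted a s \<subseteq> {..s}"
  using granted_subset by (auto intro: less_imp_le)

lemma finite_granted [simp]: "finite (granted a s)"
  using granted_subset by (rule finite_subset) simp

lemma fits_granted:
  assumes "\<And>n. semimeasure (\<lambda>x. a x n)"
  shows "fits a s (granted a s)"
proof (induction s)
  case 0
  have "max (a y n) 0 = a y n" for y n
    using assms[of n] unfolding semimeasure_def by (simp add: max_absorb1)
  then show ?case using kraft_inequality_semimeasure[OF assms] by (simp add: fits_def)
next
  case (Suc s)
  then have "fits a s (granted a (Suc s))" by simp
  then show ?case unfolding fits_def by (meson Suc_leD)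
qed

lemma eventual_request_granted:
  assumes a: "\<And>n. semimeasure (\<lambda>x. a x n)"
    and ge: "\<And>n. s \<le> n \<Longrightarrow> (1 / 2) ^ requested_exponent s \<le> a (requested_string s) n"
  shows "s \<in> granted a (Suc s)"
proof -
  have "fits a s (insert s (granted a s))" unfolding fits_def
  proof (intro allI impI)
    fix n assume n: "s \<le> n"
    then have kraft: "kraft_inequality (\<lambda>y. max (a y n) (requested_weight (granted a s) y))"
      using fits_granted[where a = a, OF a] unfolding fits_def by blast
    have weight_le: "requested_weight (insert s (granted a s)) y
        \<le> max (a y n) (requested_weight (granted a s) y)" for y
      using ge[OF n] by (intro requested_weight_insert_le) (auto intro: max.coboundedI1)
    from kraft show
      "kraft_inequality (\<lambda>y. max (a y n) (requested_weight (insert s (granted a s)) y))"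
      by (rule kraft_inequality_mono) (use weight_le in simp)
  qed
  then show ?thesis by simp
qed

lemma computable_set_encode_granted:
  assumes "cond_lsc_semimeasure {} a"
  shows "computable halting_problem (\<lambda>s. set_encode (granted a s))"
proof (rule computable_primrec[where F = "\<lambda>x s. set_encode (granted a s)" and b = "\<lambda>x. 0"
      and m = "\<lambda>s. s" and g = "\<lambda>x s e. if fits a s (set_decode (2 ^ s + e)) then 2 ^ s + e else e"])
  fix s
  have "s \<notin> granted a s" using granted_subset by blast
  then have insert: "2 ^ s + set_encode (granted a s) = set_encode (insert s (granted a s))"
    by (simp add: set_encode_insert)
  show "set_encode (granted a (Suc s)) = (if fits a s (set_decode (2 ^ s + set_encode (granted a s)))
      then 2 ^ s + set_encode (granted a s) else set_encode (granted a s))"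
    unfolding insert by simp
next
  show "computable3 halting_problem
      (\<lambda>x s e. if fits a s (set_decode (2 ^ s + e)) then 2 ^ s + e else e)"
    by (intro computable_intros decidable_comp2[OF decidable_fits[OF assms]])
qed (simp, (intro computable_intros)+)

lemma kraft_weights_granted:
  assumes "\<And>n. semimeasure (\<lambda>x. a x n)"
  shows "kraft_weights (\<lambda>y k. requested_numerator (granted a k) y k)"
proof
  have weight: "dyadic (requested_numerator (granted a k) y k) k = requested_weight (granted a k) y"
    for y k
    using granted_subset_atMost by (rule dyadic_requested_numerator)
  show "incseq (\<lambda>k. dyadic (requested_numerator (granted a k) y k) k)" for y
    unfolding weight by (intro incseq_SucI requested_weight_mono) auto
  show "kraft_inequality (\<lambda>y. dyadic (requested_numerator (granted a k) y k) k)" for k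
  proof -
    have "kraft_inequality (\<lambda>y. max (a y k) (requested_weight (granted a k) y))"
      using fits_granted[where a = a, OF assms] unfolding fits_def by blast
    then show ?thesis unfolding weight by (rule kraft_inequality_mono) simp
  qed
qed

lemma half_power_bracket:
  fixes r :: real
  assumes "0 < r" "r \<le> 1"
  obtains j where "(1 / 2) ^ j \<le> r" "r \<le> 2 * (1 / 2) ^ j"
proof -
  have "\<exists>j. (1 / 2) ^ j \<le> r"
    using real_arch_pow_inv[OF assms(1), of "1 / 2"] by (auto intro: less_imp_le)
  define j where "j = (LEAST j. (1 / 2) ^ j \<le> r)"
  have "(1 / 2) ^ j \<le> r" unfolding j_def using \<open>\<exists>j. (1 / 2) ^ j \<le> r\<close> by (rule LeastI_ex)
  moreover have "r \<le> 2 * (1 / 2) ^ j"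
  proof (cases j)
    case 0
    then show ?thesis using assms(2) by simp
  next
    case (Suc i)
    then have "\<not> (1 / 2) ^ i \<le> r"
      using not_less_Least[of i "\<lambda>j. (1 / 2) ^ j \<le> r"] by (simp add: j_def)
    then show ?thesis using Suc by simp
  qed
  ultimately show thesis using that by blast
qed

lemma liminf_le_halting_semimeasure:
  assumes cond_lsc: "cond_lsc_semimeasure {} a"
  obtains b where "lsc_semimeasure halting_problem b"
    and "\<And>x r. 0 < r \<Longrightarrow> \<forall>\<^sub>F n in sequentially. r \<le> a x n \<Longrightarrow> r \<le> 2 * b x"
proof -
  have a: "\<And>n. semimeasure (\<lambda>x. a x n)" using cond_lsc unfolding cond_lsc_semimeasure_def by blast
  have "computable3 halting_problem
      (\<lambda>i n k. requested_numerator (set_decode (set_encode (granted a k))) (string_of i) k)"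
    by (intro computable_comp3[OF computable_requested_numerator] computable_intros
        computable_comp[OF computable_set_encode_granted[OF cond_lsc]])
  then have "computable3 halting_problem
      (\<lambda>i n k. requested_numerator (granted a k) (string_of i) k)"
    by simp
  from cond_lsc_semimeasure_of_weights[where H = "\<lambda>y n k. requested_numerator (granted a k) y k",
      OF this kraft_weights_granted[OF a]]
  obtain b where b: "cond_lsc_semimeasure halting_problem b"
    and b_ge: "\<And>x n k. dyadic (requested_numerator (granted a k) x k) k \<le> b x n"
    by blast
  have "r \<le> 2 * b x 0" if "0 < r" and ev: "\<forall>\<^sub>F n in sequentially. r \<le> a x n" for x r
  proof -
    obtain N where N: "\<And>n. N \<le> n \<Longrightarrow> r \<le> a x n" using ev unfolding eventually_sequentially by blast
    then have "r \<le> 1" using a[of N] unfolding semimeasure_def by (meson order_refl order_trans)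
    with \<open>0 < r\<close> obtain j where j: "(1 / 2) ^ j \<le> r" "r \<le> 2 * (1 / 2) ^ j"
      by (rule half_power_bracket)
    define s where "s = prod_encode (prod_encode (node x, j), N)"
    have s: "N \<le> s" "requested_string s = x" "requested_exponent s = j"
      unfolding s_def requested_string_def requested_exponent_def
      by (simp_all add: le_prod_encode_2)
    have "s \<in> granted a (Suc s)"
      using a N j(1) s by (intro eventual_request_granted) (auto intro: order_trans)
    then have "(1 / 2) ^ j \<le> requested_weight (granted a (Suc s)) x"
      using requested_weight_ge[of "granted a (Suc s)" s] s by (simp del: granted.simps)
    also have "\<dots> = dyadic (requested_numerator (granted a (Suc s)) x (Suc s)) (Suc s)"
      by (intro dyadic_requested_numerator[symmetric] granted_subset_atMost)
    also have "\<dots> \<le> b x 0" by (rule b_ge)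
    finally show ?thesis using j(2) by linarith
  qed
  then show thesis using lsc_semimeasure_of_cond[OF b] that by blast
qed

section \<open>Comparison of the complexities\<close>

lemma neg_log2_antimono: "0 < p \<Longrightarrow> p \<le> q \<Longrightarrow> neg_log2 q \<le> neg_log2 p"
  by (simp add: neg_log2_def)

lemma limsup_neg_log2_le:
  assumes "0 < p" "\<forall>\<^sub>F n in sequentially. p \<le> f n"
  shows "limsup (\<lambda>n. neg_log2 (f n)) \<le> neg_log2 p"
proof (rule Limsup_bounded)
  show "\<forall>\<^sub>F n in sequentially. neg_log2 (f n) \<le> neg_log2 p"
    using assms(2) by eventually_elim (rule neg_log2_antimono[OF assms(1)])
qed

lemma neg_log2_le_limsup:
  assumes "0 < q" and le_q: "\<And>r. 0 < r \<Longrightarrow> \<forall>\<^sub>F n in sequentially. r \<le> f n \<Longrightarrow> r \<le> q"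
  shows "neg_log2 q \<le> limsup (\<lambda>n. neg_log2 (f n))"
proof (rule ccontr)
  assume "\<not> neg_log2 q \<le> limsup (\<lambda>n. neg_log2 (f n))"
  then obtain d where d: "limsup (\<lambda>n. neg_log2 (f n)) < ereal d" "ereal d < neg_log2 q"
    using ereal_dense2 by (metis not_le)
  have "\<forall>\<^sub>F n in sequentially. neg_log2 (f n) < ereal d" using d(1) by (rule Limsup_lessD)
  then have "\<forall>\<^sub>F n in sequentially. 2 powr - d \<le> f n"
  proof eventually_elim
    case (elim n)
    then have "0 < f n" "- log 2 (f n) < d"
      unfolding neg_log2_def by (auto split: if_splits)
    then show ?case by (simp add: powr_le_iff)
  qed
  then have "2 powr - d \<le> q" by (intro le_q) simp_all
  then show False using d(2) \<open>0 < q\<close> by (simp add: neg_log2_def powr_le_iff)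
qed

lemma limsup_KA_cond_le_KA:
  assumes a: "maximal_cond_lsc_semimeasure {} a"
    and a0: "maximal_lsc_semimeasure halting_problem a0"
  obtains c where "\<And>x. limsup (KA_cond a x) \<le> KA a0 x + ereal c"
proof -
  obtain b where "cond_lsc_semimeasure {} b"
    and b: "\<And>x r. r < a0 x \<Longrightarrow> \<forall>\<^sub>F n in sequentially. r \<le> b x n"
    using a0 halting_semimeasure_le_liminf unfolding maximal_lsc_semimeasure_def by blast
  then obtain C where C: "0 < C" "\<And>x n. b x n \<le> C * a x n"
    using a unfolding maximal_cond_lsc_semimeasure_def by blast
  show thesis
  proof
    fix x
    have pos: "0 < a0 x" using a0 by (rule maximal_lsc_semimeasure_pos)
    then have "\<forall>\<^sub>F n in sequentially. a0 x / 2 \<le> b x n" by (intro b) simp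
    then have "\<forall>\<^sub>F n in sequentially. a0 x / (2 * C) \<le> a x n"
    proof eventually_elim
      case (elim n)
      then show ?case using C(1) C(2)[of x n] by (simp add: field_simps)
    qed
    then have "limsup (KA_cond a x) \<le> neg_log2 (a0 x / (2 * C))"
      unfolding KA_cond_def using pos C(1) by (intro limsup_neg_log2_le) simp_all
    then show "limsup (KA_cond a x) \<le> KA a0 x + ereal (log 2 (2 * C))"
      using pos C(1) by (simp add: KA_def neg_log2_def log_divide)
  qed
qed

lemma KA_le_limsup_KA_cond:
  assumes a: "maximal_cond_lsc_semimeasure {} a"
    and a0: "maximal_lsc_semimeasure halting_problem a0"
  obtains c where "\<And>x. KA a0 x \<le> limsup (KA_cond a x) + ereal c"
proof -
  obtain b where "lsc_semimeasure halting_problem b"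
    and b: "\<And>x r. 0 < r \<Longrightarrow> \<forall>\<^sub>F n in sequentially. r \<le> a x n \<Longrightarrow> r \<le> 2 * b x"
    using a liminf_le_halting_semimeasure unfolding maximal_cond_lsc_semimeasure_def by blast
  then obtain C where C: "0 < C" "\<And>x. b x \<le> C * a0 x"
    using a0 unfolding maximal_lsc_semimeasure_def by blast
  show thesis
  proof
    fix x
    have pos: "0 < a0 x" using a0 by (rule maximal_lsc_semimeasure_pos)
    have "neg_log2 (2 * C * a0 x) \<le> limsup (KA_cond a x)"
      unfolding KA_cond_def
    proof (rule neg_log2_le_limsup)
      show "r \<le> 2 * C * a0 x" if "0 < r" "\<forall>\<^sub>F n in sequentially. r \<le> a x n" for r
        using b[OF that] C(2)[of x] by linarith
    qed (use pos C(1) in simp)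
    then show "KA a0 x \<le> limsup (KA_cond a x) + ereal (log 2 (2 * C))"
      using pos C(1) unfolding KA_def
      by (cases "limsup (KA_cond a x)") (simp_all add: neg_log2_def log_mult)
  qed
qed

theorem theorem5:
  fixes a :: "bool list \<Rightarrow> nat \<Rightarrow> real" and a0 :: "bool list \<Rightarrow> real"
  assumes "maximal_cond_lsc_semimeasure {} a"
    and "maximal_lsc_semimeasure halting_problem a0"
  shows "\<exists>c::real. \<forall>x::bool list.
    \<bar>limsup (\<lambda>n. KA_cond a x n) - KA a0 x\<bar> \<le> ereal c"
proof -
  obtain c where upper: "\<And>x. limsup (KA_cond a x) \<le> KA a0 x + ereal c"
    using limsup_KA_cond_le_KA[OF assms] by blast
  obtain d where lower: "\<And>x. KA a0 x \<le> limsup (KA_cond a x) + ereal d"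
    using KA_le_limsup_KA_cond[OF assms] by blast
  have "\<bar>limsup (KA_cond a x) - KA a0 x\<bar> \<le> ereal (max c d)" for x
  proof -
    have "KA a0 x = ereal (- log 2 (a0 x))"
      using maximal_lsc_semimeasure_pos[OF assms(2)] by (simp add: KA_def neg_log2_def)
    then show ?thesis
      using upper[of x] lower[of x] by (cases "limsup (KA_cond a x)") (auto simp: max_def)
  qed
  then show ?thesis by blast
qed

end
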